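(* For $1\le i\le r$ and $k\ge 1$ let $\theta_{i,k}\in\mathbb{C}[A]$ be the function $\theta_{i,k}(a):=\Delta_{\varpi_i,\varpi_i}(a^k)$ $(a\in A)$, and put $\theta_{i,0}:=1$. Then for all $k\ge 1$ and $1\le i\le r$, $$\theta_{i,k}^2=\theta_{i,k-1}\,\theta_{i,k+1}+\prod_{j:\ c_{ij}=-1}\theta_{j,k}.$$
   Context: $G$ is a simple, simply connected algebraic group over $\mathbb{C}$ of Cartan type $A$, $D$ or $E$, of rank $r$, with Cartan matrix $(c_{ij})_{1\le i,j\le r}$. $T$ is a maximal torus, $B\supset T$ a Borel subgroup with unipotent radical $U$, $B^-$ the opposite Borel subgroup with unipotent radical $U^-$, $W=N(T)/T$ the Weyl group with simple reflections $s_1,\dots,s_r$, and $\varpi_1,\dots,\varpi_r$ the fundamental weights. $c=s_{i_1}\cdots s_{i_r}$ is a Coxeter element (product of all the simple reflections, each once, in some order). Let $\overline{s_i}\in N(T)$ be the image of $\left(\begin{array}{cc}0&-1\\1&0\end{array}\right)$ under the homomorphism $SL_2\to G$ attached to the simple root $\alpha_i$; for $w\in W$ let $\overline{w}$ be the product of the $\overline{s_i}$'s along any reduced word of $w$; thus $\overline{c}=\overline{s_{i_1}}\cdots\overline{s_{i_r}}$. Put $U(c^{-1}):=U\cap(\overline{c}\,U^-\,\overline{c}^{-1})$ and $A:=U(c^{-1})\,\overline{c}\subset G$ (an affine space of dimension $r$). $\Delta_{\varpi_i,\varpi_i}\in\mathbb{C}[G]$ is the principal generalized minor of Fomin and Zelevinsky: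 the regular function on $G$ which at $x=n^-tn$ with $n^-\in U^-$, $t\in T$, $n\in U$ takes the value $\varpi_i(t)$ (for $SL(n)$ it is the leading principal minor of size $i$). *)

theory Defs
  imports
    "HOL-Analysis.Analysis"
    "HOL-Algebra.Solvable_Groups"
    "HOL-Computational_Algebra.Polynomial"
begin

section \<open>Linear algebraic groups over the complex numbers\<close>

text \<open>
  A linear algebraic group is a Zariski closed subgroup of the general linear group
  \<open>GL\<close> over the complex numbers; the matrix size is the cardinality of the index type
  \<open>'n\<close>. Groups are represented by their sets of elements, and \<open>GLs G\<close> is the group
  (in the sense of HOL-Algebra) with underlying set \<open>G\<close>.
\<close>

definition mat_monoid :: "(complex^'n^'n) monoid" where
  "mat_monoid = \<lparr>carrier = UNIV, mult = (**), one = mat 1\<rparr>"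

definition GLs :: "(complex^'n^'n) set \<Rightarrow> (complex^'n^'n) monoid" where
  "GLs G = mat_monoid\<lparr>carrier := G\<rparr>"

abbreviation GL :: "(complex^'n^'n) monoid" where
  "GL \<equiv> GLs {x. invertible x}"

text \<open>The coordinate ring of \<open>GL\<close>: polynomials in the entries and in \<open>1 / det\<close>.\<close>

inductive regular :: "(complex^'n^'n \<Rightarrow> complex) \<Rightarrow> bool" where
  const: "regular (\<lambda>x. z)"
| entry: "regular (\<lambda>x. x $ i $ j)"
| inv_det: "regular (\<lambda>x. inverse (det x))"
| add: "regular f \<Longrightarrow> regular g \<Longrightarrow> regular (\<lambda>x. f x + g x)"
| mult: "regular f \<Longrightarrow> regular g \<Longrightarrow> regular (\<lambda>x. f x * g x)"

definition regular_on :: "(complex^'n^'n) set \<Rightarrow> (complex^'n^'n \<Rightarrow> complex) \<Rightarrow> bool" where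
  "regular_on X f \<longleftrightarrow> (\<exists>g. regular g \<and> (\<forall>x\<in>X. f x = g x))"

definition zariski_closed :: "(complex^'n^'n) set \<Rightarrow> bool" where
  "zariski_closed X \<longleftrightarrow>
     (\<exists>F. (\<forall>f\<in>F. regular f) \<and> X = {x. invertible x \<and> (\<forall>f\<in>F. f x = 0)})"

definition zariski_connected :: "(complex^'n^'n) set \<Rightarrow> bool" where
  "zariski_connected X \<longleftrightarrow>
     \<not> (\<exists>Y Z. zariski_closed Y \<and> zariski_closed Z \<and> X \<subseteq> Y \<union> Z \<and>
            X \<inter> Y \<inter> Z = {} \<and> X \<inter> Y \<noteq> {} \<and> X \<inter> Z \<noteq> {})"

definition alg_group :: "(complex^'n^'n) set \<Rightarrow> bool" where
  "alg_group G \<longleftrightarrow> subgroup G GL \<and> zariski_closed G"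

definition connected_alg_group :: "(complex^'n^'n) set \<Rightarrow> bool" where
  "connected_alg_group G \<longleftrightarrow> alg_group G \<and> zariski_connected G"

definition simple_alg_group :: "(complex^'n^'n) set \<Rightarrow> bool" where
  "simple_alg_group G \<longleftrightarrow>
     connected_alg_group G \<and>
     (\<exists>x\<in>G. \<exists>y\<in>G. x ** y \<noteq> y ** x) \<and>
     (\<forall>N. connected_alg_group N \<longrightarrow> normal N (GLs G) \<longrightarrow> N = {mat 1} \<or> N = G)"

definition alg_hom ::
  "(complex^'m^'m) set \<Rightarrow> (complex^'n^'n) set \<Rightarrow> (complex^'m^'m \<Rightarrow> complex^'n^'n) \<Rightarrow> bool" where
  "alg_hom H G f \<longleftrightarrow> f \<in> hom (GLs H) (GLs G) \<and> (\<forall>i j. regular_on H (\<lambda>x. f x $ i $ j))"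


section \<open>Tori, Borel subgroups, unipotent radicals\<close>

definition diagonal :: "complex^'n^'n \<Rightarrow> bool" where
  "diagonal x \<longleftrightarrow> (\<forall>i j. i \<noteq> j \<longrightarrow> x $ i $ j = 0)"

definition alg_torus :: "(complex^'n^'n) set \<Rightarrow> bool" where
  "alg_torus T \<longleftrightarrow> connected_alg_group T \<and>
     (\<exists>P :: complex^'n^'n. invertible P \<and> (\<forall>t\<in>T. diagonal (P ** t ** matrix_inv P)))"

definition maximal_torus :: "(complex^'n^'n) set \<Rightarrow> (complex^'n^'n) set \<Rightarrow> bool" where
  "maximal_torus G T \<longleftrightarrow> alg_torus T \<and> T \<subseteq> G \<and>
     (\<forall>S. alg_torus S \<longrightarrow> T \<subseteq> S \<longrightarrow> S \<subseteq> G \<longrightarrow> S = T)"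

definition borel_subgroup :: "(complex^'n^'n) set \<Rightarrow> (complex^'n^'n) set \<Rightarrow> bool" where
  "borel_subgroup G B \<longleftrightarrow> connected_alg_group B \<and> solvable (GLs B) \<and> B \<subseteq> G \<and>
     (\<forall>C. connected_alg_group C \<longrightarrow> solvable (GLs C) \<longrightarrow> B \<subseteq> C \<longrightarrow> C \<subseteq> G \<longrightarrow> C = B)"

definition opposite_borels ::
  "(complex^'n^'n) set \<Rightarrow> (complex^'n^'n) set \<Rightarrow> (complex^'n^'n) set \<Rightarrow> (complex^'n^'n) set \<Rightarrow> bool" where
  "opposite_borels G T B Bm \<longleftrightarrow> borel_subgroup G B \<and> borel_subgroup G Bm \<and> B \<inter> Bm = T"

definition unipotent :: "complex^'n^'n \<Rightarrow> bool" where
  "unipotent x \<longleftrightarrow> (\<exists>k::nat. (x - mat 1) [^]\<^bsub>mat_monoid\<^esub> k = 0)"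

definition unipotent_normal :: "(complex^'n^'n) set \<Rightarrow> (complex^'n^'n) set \<Rightarrow> bool" where
  "unipotent_normal B U \<longleftrightarrow>
     connected_alg_group U \<and> normal U (GLs B) \<and> (\<forall>u\<in>U. unipotent u)"

definition unipotent_radical :: "(complex^'n^'n) set \<Rightarrow> (complex^'n^'n) set \<Rightarrow> bool" where
  "unipotent_radical B U \<longleftrightarrow>
     unipotent_normal B U \<and> (\<forall>V. unipotent_normal B V \<longrightarrow> V \<subseteq> U)"


section \<open>Characters and roots\<close>

text \<open>Characters are written multiplicatively, and only their values on \<open>T\<close> matter.\<close>

definition alg_character :: "(complex^'n^'n) set \<Rightarrow> (complex^'n^'n \<Rightarrow> complex) \<Rightarrow> bool" where
  "alg_character T \<xi> \<longleftrightarrow> regular_on T \<xi> \<and>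
     (\<forall>s\<in>T. \<forall>t\<in>T. \<xi> (s ** t) = \<xi> s * \<xi> t) \<and> (\<forall>t\<in>T. \<xi> t \<noteq> 0)"

text \<open>
  \<open>root_subgroup G T \<beta> x\<close>: \<open>x\<close> is a nontrivial morphism from the additive group to \<open>G\<close>,
  normalized by \<open>T\<close> through \<open>\<beta>\<close>. The condition that \<open>\<beta>\<close> be nontrivial is left out:
  in a reductive group the centralizer of a maximal torus \<open>T\<close> is \<open>T\<close>, so \<open>\<beta>\<close> is never
  trivial.
\<close>

definition root_subgroup ::
  "(complex^'n^'n) set \<Rightarrow> (complex^'n^'n) set \<Rightarrow> (complex^'n^'n \<Rightarrow> complex) \<Rightarrow>
   (complex \<Rightarrow> complex^'n^'n) \<Rightarrow> bool" where
  "root_subgroup G T \<beta> x \<longleftrightarrow>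
     alg_character T \<beta> \<and>
     range x \<subseteq> G \<and> (\<forall>a b. x (a + b) = x a ** x b) \<and>
     (\<forall>i j. \<exists>p. \<forall>a. x a $ i $ j = poly p a) \<and> (\<exists>a. x a \<noteq> mat 1) \<and>
     (\<forall>t\<in>T. \<forall>a. t ** x a ** matrix_inv t = x (\<beta> t * a))"

definition is_root :: "(complex^'n^'n) set \<Rightarrow> (complex^'n^'n) set \<Rightarrow> (complex^'n^'n \<Rightarrow> complex) \<Rightarrow> bool"
  where "is_root G T \<beta> \<longleftrightarrow> (\<exists>x. root_subgroup G T \<beta> x)"

definition char_comb ::
  "('r::finite \<Rightarrow> complex^'n^'n \<Rightarrow> complex) \<Rightarrow> ('r \<Rightarrow> int) \<Rightarrow> complex^'n^'n \<Rightarrow> complex" where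
  "char_comb \<alpha> m t = (\<Prod>i\<in>UNIV. \<alpha> i t powi m i)"

text \<open>
  The simple roots determined by \<open>B\<close>: the base of the root system whose positive roots are
  the roots of \<open>B\<close> (those with root subgroup in the unipotent radical \<open>U\<close> of \<open>B\<close>), the
  negative ones being the roots of the opposite Borel subgroup, with unipotent radical \<open>Um\<close>.
\<close>

definition simple_roots ::
  "(complex^'n^'n) set \<Rightarrow> (complex^'n^'n) set \<Rightarrow> (complex^'n^'n) set \<Rightarrow> (complex^'n^'n) set \<Rightarrow>
   ('r::finite \<Rightarrow> complex^'n^'n \<Rightarrow> complex) \<Rightarrow> bool" where
  "simple_roots G T U Um \<alpha> \<longleftrightarrow>
     (\<forall>i. is_root G T (\<alpha> i)) \<and>
     (\<forall>m. (\<forall>t\<in>T. char_comb \<alpha> m t = 1) \<longrightarrow> m = (\<lambda>i. 0)) \<and>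
     (\<forall>\<beta> x. root_subgroup G T \<beta> x \<longrightarrow>
        (\<exists>m. m \<noteq> (\<lambda>i. 0) \<and> (\<forall>t\<in>T. \<beta> t = char_comb \<alpha> m t) \<and>
             ((\<forall>i. 0 \<le> m i) \<and> range x \<subseteq> U \<or> (\<forall>i. m i \<le> 0) \<and> range x \<subseteq> Um)))"


section \<open>The homomorphisms from SL(2), coroots, and the Cartan type\<close>

definition mat2 :: "complex \<Rightarrow> complex \<Rightarrow> complex \<Rightarrow> complex \<Rightarrow> complex^2^2" where
  "mat2 a b c d = vector [vector [a, b], vector [c, d]]"

definition SL2 :: "(complex^2^2) set" where
  "SL2 = {g. det g = 1}"

definition coroot :: "(complex^2^2 \<Rightarrow> complex^'n^'n) \<Rightarrow> complex \<Rightarrow> complex^'n^'n" where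
  "coroot \<phi> z = \<phi> (mat2 z 0 0 (inverse z))"

text \<open>
  \<open>\<phi>\<close> is a homomorphism from \<open>SL2\<close> attached to the root \<open>\<alpha>\<close>. It is determined by \<open>\<alpha>\<close> up to
  conjugation by the diagonal torus of \<open>PGL2\<close>, i.e. up to the choice of a root vector.
\<close>

definition attached ::
  "(complex^'n^'n) set \<Rightarrow> (complex^'n^'n) set \<Rightarrow> (complex^'n^'n \<Rightarrow> complex) \<Rightarrow>
   (complex^2^2 \<Rightarrow> complex^'n^'n) \<Rightarrow> bool" where
  "attached G T \<alpha> \<phi> \<longleftrightarrow> alg_hom SL2 G \<phi> \<and>
     (\<forall>z. z \<noteq> 0 \<longrightarrow> coroot \<phi> z \<in> T) \<and>
     root_subgroup G T \<alpha> (\<lambda>a. \<phi> (mat2 1 a 0 1)) \<and>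
     root_subgroup G T (\<lambda>t. inverse (\<alpha> t)) (\<lambda>a. \<phi> (mat2 1 0 a 1))"

definition cartan_matrix ::
  "('r \<Rightarrow> complex^'n^'n \<Rightarrow> complex) \<Rightarrow> ('r \<Rightarrow> complex^2^2 \<Rightarrow> complex^'n^'n) \<Rightarrow>
   ('r \<Rightarrow> 'r \<Rightarrow> int) \<Rightarrow> bool" where
  "cartan_matrix \<alpha> \<phi> c \<longleftrightarrow> (\<forall>i j z. z \<noteq> 0 \<longrightarrow> \<alpha> j (coroot (\<phi> i) z) = z powi c i j)"

text \<open>
  Edges \<open>(p, q)\<close> with \<open>p < q\<close> of the Dynkin diagrams on the vertices \<open>1, \<dots>, r\<close>,
  numbered as in Bourbaki.
\<close>

definition edges_A :: "nat \<Rightarrow> (nat \<times> nat) set" where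
  "edges_A r = {(p, p + 1) | p. 1 \<le> p \<and> p + 1 \<le> r}"

definition edges_D :: "nat \<Rightarrow> (nat \<times> nat) set" where
  "edges_D r = {(p, p + 1) | p. 1 \<le> p \<and> p + 1 \<le> r - 1} \<union> {(r - 2, r)}"

definition edges_E :: "nat \<Rightarrow> (nat \<times> nat) set" where
  "edges_E r = {(1, 3), (2, 4)} \<union> {(p, p + 1) | p. 3 \<le> p \<and> p + 1 \<le> r}"

definition type_ADE :: "('r::finite \<Rightarrow> 'r \<Rightarrow> int) \<Rightarrow> bool" where
  "type_ADE c \<longleftrightarrow>
     (\<exists>E e. (E = edges_A CARD('r) \<or>
             E = edges_D CARD('r) \<and> 4 \<le> CARD('r) \<or>
             E = edges_E CARD('r) \<and> CARD('r) \<in> {6, 7, 8}) \<and>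
            bij_betw e (UNIV :: 'r set) {1..CARD('r)} \<and>
            (\<forall>i j. c i j = (if i = j then 2
                            else if (e i, e j) \<in> E \<or> (e j, e i) \<in> E then -1 else 0)))"

text \<open>
  A semisimple group is simply connected iff its character group is the whole weight lattice,
  i.e. the characters of \<open>T\<close> correspond bijectively, via the pairing with the simple coroots,
  to the integer valued functionals on the coroot lattice.
\<close>

definition simply_connected_group ::
  "(complex^'n^'n) set \<Rightarrow> ('r \<Rightarrow> complex^2^2 \<Rightarrow> complex^'n^'n) \<Rightarrow> bool" where
  "simply_connected_group T \<phi> \<longleftrightarrow>
     (\<forall>m :: 'r \<Rightarrow> int.
        (\<exists>\<xi>. alg_character T \<xi> \<and> (\<forall>j z. z \<noteq> 0 \<longrightarrow> \<xi> (coroot (\<phi> j) z) = z powi m j)) \<and>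
        (\<forall>\<xi> \<eta>. alg_character T \<xi> \<longrightarrow> (\<forall>j z. z \<noteq> 0 \<longrightarrow> \<xi> (coroot (\<phi> j) z) = z powi m j) \<longrightarrow>
               alg_character T \<eta> \<longrightarrow> (\<forall>j z. z \<noteq> 0 \<longrightarrow> \<eta> (coroot (\<phi> j) z) = z powi m j) \<longrightarrow>
               (\<forall>t\<in>T. \<xi> t = \<eta> t)))"

definition fundamental_weights ::
  "(complex^'n^'n) set \<Rightarrow> ('r \<Rightarrow> complex^2^2 \<Rightarrow> complex^'n^'n) \<Rightarrow>
   ('r \<Rightarrow> complex^'n^'n \<Rightarrow> complex) \<Rightarrow> bool" where
  "fundamental_weights T \<phi> \<omega> \<longleftrightarrow>
     (\<forall>i. alg_character T (\<omega> i) \<and>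
          (\<forall>j z. z \<noteq> 0 \<longrightarrow> \<omega> i (coroot (\<phi> j) z) = (if i = j then z else 1)))"


section \<open>Principal minors, Coxeter elements, and the slice\<close>

text \<open>
  The principal generalized minor of weight \<open>\<omega>\<close> is the regular function on \<open>G\<close> with the
  prescribed values on the elements having a Gaussian decomposition; \<open>principal_minor\<close> spells
  out this definite description.
\<close>

definition minor_values ::
  "(complex^'n^'n) set \<Rightarrow> (complex^'n^'n) set \<Rightarrow> (complex^'n^'n) set \<Rightarrow>
   (complex^'n^'n \<Rightarrow> complex) \<Rightarrow> (complex^'n^'n \<Rightarrow> complex) \<Rightarrow> bool" where
  "minor_values T U Um \<omega> f \<longleftrightarrow> (\<forall>n\<in>Um. \<forall>t\<in>T. \<forall>u\<in>U. f (n ** t ** u) = \<omega> t)"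

definition principal_minor ::
  "(complex^'n^'n) set \<Rightarrow> (complex^'n^'n) set \<Rightarrow> (complex^'n^'n) set \<Rightarrow> (complex^'n^'n) set \<Rightarrow>
   (complex^'n^'n \<Rightarrow> complex) \<Rightarrow> (complex^'n^'n \<Rightarrow> complex) \<Rightarrow> bool" where
  "principal_minor G T U Um \<omega> \<Delta> \<longleftrightarrow>
     regular_on G \<Delta> \<and> minor_values T U Um \<omega> \<Delta> \<and>
     (\<forall>f. regular_on G f \<longrightarrow> minor_values T U Um \<omega> f \<longrightarrow> (\<forall>x\<in>G. f x = \<Delta> x))"

definition refl_rep :: "(complex^2^2 \<Rightarrow> complex^'n^'n) \<Rightarrow> complex^'n^'n" where
  "refl_rep \<phi> = \<phi> (mat2 0 (-1) 1 0)"

text \<open>The representative in \<open>N(T)\<close> of the Weyl group element with the given reduced word.\<close>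

definition word_rep :: "('r \<Rightarrow> complex^2^2 \<Rightarrow> complex^'n^'n) \<Rightarrow> 'r list \<Rightarrow> complex^'n^'n" where
  "word_rep \<phi> w = foldr (\<lambda>i x. refl_rep (\<phi> i) ** x) w (mat 1)"

text \<open>A word for a Coxeter element: each simple reflection occurs exactly once.\<close>

definition coxeter_word :: "'r::finite list \<Rightarrow> bool" where
  "coxeter_word w \<longleftrightarrow> distinct w \<and> set w = UNIV"

definition coxeter_slice ::
  "(complex^'n^'n) set \<Rightarrow> (complex^'n^'n) set \<Rightarrow> complex^'n^'n \<Rightarrow> (complex^'n^'n) set" where
  "coxeter_slice U Um cbar =
     {u ** cbar | u. u \<in> U \<inter> {cbar ** n ** matrix_inv cbar | n. n \<in> Um}}"

definition theta ::
  "('r \<Rightarrow> complex^'n^'n \<Rightarrow> complex) \<Rightarrow> 'r \<Rightarrow> nat \<Rightarrow> complex^'n^'n \<Rightarrow> complex" where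
  "theta \<Delta> i k a = (if k = 0 then 1 else \<Delta> i (a [^]\<^bsub>mat_monoid\<^esub> k))"

end

theory Submission
  imports Defs
begin

text \<open>
  Put \<open>s = nr i (-1)\<close>, the inverse of the representative of \<open>s\<^sub>i\<close>. Everything rests on the identity
  \<open>\<Delta>\<^sub>i(y) \<Delta>\<^sub>i(s y s) = \<Delta>\<^sub>i(s y) \<Delta>\<^sub>i(y s) - \<Prod>\<^sub>j \<Delta>\<^sub>j(y)\<close> on \<open>G\<close>, the product being over the neighbours \<open>j\<close> of \<open>i\<close>.
  If \<open>a = u c = c n\<close> lies in the slice and \<open>c = p s\<^sup>-\<^sup>1 q\<close>, it is applied to
  \<open>y = p\<^sup>-\<^sup>1 a\<^sup>k\<^sup>+\<^sup>1 q\<^sup>-\<^sup>1\<close>: since \<open>c\<^sup>-\<^sup>1 a = n\<close> and \<open>a c\<^sup>-\<^sup>1 = u\<close>, and since \<open>\<Delta>\<^sub>j\<close> is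
  invariant under the representatives of the \<open>s\<^sub>l\<close> with \<open>l \<noteq> j\<close> on both sides, the minors
  become the functions \<open>\<theta>\<close>.

  By density it is enough to prove the identity on the open cell, where it reduces to the fact
  that \<open>u \<mapsto> \<Delta>\<^sub>i(u s)\<close> is additive on \<open>U\<close> and its counterpart on \<open>U\<^sup>-\<close>. This function has weight
  \<open>\<alpha>\<^sub>i\<close> under conjugation by \<open>T\<close>. The exponential map shows that the weights of \<open>T\<close> on
  the Lie algebra of \<open>U\<close> are roots, hence nonnegative combinations of the simple roots, so a
  regular function of weight \<open>\<alpha>\<^sub>i\<close> can only involve terms of first order. Neither the
  decomposition of \<open>U\<close> into root subgroups nor the dimension of root spaces is needed.
\<close>


section \<open>Matrices\<close>

primrec mpow :: "complex^'n^'n \<Rightarrow> nat \<Rightarrow> complex^'n^'n" where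
  "mpow A 0 = mat 1"
| "mpow A (Suc k) = mpow A k ** A"

lemma mat_monoid_pow: "A [^]\<^bsub>mat_monoid\<^esub> (k::nat) = mpow A k"
  by (induct k) (simp_all add: mat_monoid_def)

text \<open>The scalars have to be complex: they are values of curve parameters and of
  characters.\<close>

definition smul :: "complex \<Rightarrow> complex^'n^'n \<Rightarrow> complex^'n^'n" where
  "smul c A = (\<chi> i j. c * A $ i $ j)"

lemma smul_nth [simp]: "smul c A $ i $ j = c * A $ i $ j"
  by (simp add: smul_def)

lemma mat_eqI: "(\<And>i j. A $ i $ j = B $ i $ j) \<Longrightarrow> A = B"
  by (simp add: vec_eq_iff)

lemma mmult_nth: "(A ** B) $ i $ j = (\<Sum>k\<in>UNIV. A $ i $ k * B $ k $ j)"
  by (simp add: matrix_matrix_mult_def)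

lemma smul_mult_left [simp]: "smul c A ** B = smul c (A ** B)"
  by (intro mat_eqI) (simp add: mmult_nth sum_distrib_left mult.assoc)

lemma smul_mult_right [simp]: "A ** smul c B = smul c (A ** B)"
  by (intro mat_eqI) (simp add: mmult_nth sum_distrib_left algebra_simps)

lemma smul_smul [simp]: "smul c (smul d A) = smul (c * d) A"
  by (intro mat_eqI) (simp add: mult.assoc)

lemma smul_one [simp]: "smul 1 A = A"
  by (intro mat_eqI) simp

lemma smul_zero [simp]: "smul 0 A = 0" "smul c 0 = 0"
  by (intro mat_eqI; simp)+

lemma smul_add: "smul c (A + B) = smul c A + smul c B" "smul (c + d) A = smul c A + smul d A"
  by (intro mat_eqI; simp add: algebra_simps)+

lemma mmult_add_rdistrib: "(B + C) ** A = B ** A + C ** (A :: 'a::semiring_1^'n^'m)"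
  by (intro mat_eqI) (simp add: mmult_nth algebra_simps sum.distrib)

lemma mmult_sum_right: "(A :: complex^'n^'n) ** (\<Sum>x\<in>S. f x) = (\<Sum>x\<in>S. A ** f x)"
  by (induct S rule: infinite_finite_induct) (auto simp: matrix_add_ldistrib)

lemma mmult_sum_left: "(\<Sum>x\<in>S. f x) ** A = (\<Sum>x\<in>S. f x ** (A :: complex^'n^'n))"
  by (induct S rule: infinite_finite_induct) (auto simp: mmult_add_rdistrib)

lemma mmult_diff_distrib:
  fixes A B C :: "complex^'n^'n"
  shows "A ** (B - C) = A ** B - A ** C" "(A - B) ** C = A ** C - B ** C"
  by (intro mat_eqI; simp add: mmult_nth algebra_simps sum_subtractf)+

lemma mpow_add: "mpow A (j + k) = mpow A j ** mpow A k"
  by (induct k) (simp_all add: matrix_mul_assoc)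

lemma mpow_Suc2: "mpow A (Suc k) = A ** mpow A k"
  using mpow_add[of A "Suc 0" k] by simp

lemma mpow_smul: "mpow (smul c A) k = smul (c ^ k) (mpow A k)"
  by (induct k) simp_all

lemma mpow_nilpotent_mono: "mpow A k = 0 \<Longrightarrow> k \<le> l \<Longrightarrow> mpow A l = 0"
  using mpow_add[of A k "l - k"] by simp

lemma matrix_inv_mult:
  assumes "invertible (A :: complex^'n^'n)"
  shows "A ** matrix_inv A = mat 1" "matrix_inv A ** A = mat 1"
  using someI_ex[of "\<lambda>B. A ** B = mat 1 \<and> B ** A = mat 1"] assms
  unfolding matrix_inv_def invertible_def by auto

lemma matrix_inv_eqI: "A ** B = mat 1 \<Longrightarrow> matrix_inv A = (B :: complex^'n^'n)"
  by (metis invertible_def matrix_inv_mult(2) matrix_mul_assoc matrix_mul_lid matrix_mul_rid matrix_left_right_inverse1)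

lemma mat1_nth: "(mat 1 :: complex^'n^'n) $ i $ j = (if i = j then 1 else 0)"
  by (simp add: mat_def)


section \<open>Polynomial functions and polynomial matrix curves\<close>

text \<open>Polynomiality is a property of functions here, so that it can be derived by introduction
  rules.\<close>

definition polyf :: "(complex \<Rightarrow> complex) \<Rightarrow> bool" where
  "polyf f \<longleftrightarrow> (\<exists>p. \<forall>s. f s = poly p s)"

lemma polyf_const [simp, intro]: "polyf (\<lambda>s. c)"
  unfolding polyf_def by (rule exI[of _ "[:c:]"]) simp

lemma polyf_id [simp, intro]: "polyf (\<lambda>s. s)"
  unfolding polyf_def by (rule exI[of _ "[:0, 1:]"]) simp

lemma polyf_add [intro]: "polyf f \<Longrightarrow> polyf g \<Longrightarrow> polyf (\<lambda>s. f s + g s)"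
  unfolding polyf_def by (metis poly_add)

lemma polyf_diff [intro]: "polyf f \<Longrightarrow> polyf g \<Longrightarrow> polyf (\<lambda>s. f s - g s)"
  unfolding polyf_def by (metis poly_diff)

lemma polyf_minus [intro]: "polyf f \<Longrightarrow> polyf (\<lambda>s. - f s)"
  unfolding polyf_def by (metis poly_minus)

lemma polyf_mult [intro]: "polyf f \<Longrightarrow> polyf g \<Longrightarrow> polyf (\<lambda>s. f s * g s)"
  unfolding polyf_def by (metis poly_mult)

lemma polyf_power [intro]: "polyf f \<Longrightarrow> polyf (\<lambda>s. f s ^ k)"
  by (induct k) auto

lemma polyf_sum [intro]: "(\<And>x. x \<in> S \<Longrightarrow> polyf (f x)) \<Longrightarrow> polyf (\<lambda>s. \<Sum>x\<in>S. f x s)"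
  by (induct S rule: infinite_finite_induct) auto

lemma polyf_prod [intro]: "(\<And>x. x \<in> S \<Longrightarrow> polyf (f x)) \<Longrightarrow> polyf (\<lambda>s. \<Prod>x\<in>S. f x s)"
  by (induct S rule: infinite_finite_induct) auto

lemma polyf_compose: "polyf f \<Longrightarrow> polyf g \<Longrightarrow> polyf (\<lambda>s. f (g s))"
  unfolding polyf_def by (metis poly_pcompose)

lemma polyf_eqI:
  assumes "polyf f" "polyf g" "infinite {s. f s = g s}"
  shows "f s = g s"
proof -
  obtain p where p: "\<And>s. f s - g s = poly p s"
    using polyf_diff[OF assms(1,2)] unfolding polyf_def by blast
  have "p = 0"
    using poly_roots_finite[of p] assms(3) by (auto simp: p[symmetric])
  then show ?thesis using p[of s] by simp
qed

lemma infinite_of_nat: "infinite (range (of_nat :: nat \<Rightarrow> complex))"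
  by (simp add: finite_image_iff inj_on_def)

text \<open>This carries identities about the powers of a unipotent matrix over to complex
  exponents.\<close>

lemma polyf_eq_nat:
  assumes "polyf f" "polyf g" "\<And>k. f (of_nat k) = g (of_nat k)"
  shows "f s = g s"
  by (rule polyf_eqI[OF assms(1,2)], rule infinite_super[OF _ infinite_of_nat]) (use assms(3) in auto)

lemma polyf_eq_nonzero:
  assumes "polyf f" "polyf g" "\<And>s. s \<noteq> 0 \<Longrightarrow> f s = g s"
  shows "f s = g s"
proof (rule polyf_eqI[OF assms(1,2)])
  have "infinite (UNIV - {0::complex})" by (simp add: infinite_UNIV_char_0)
  then show "infinite {s. f s = g s}"
    by (rule contrapos_nn) (erule finite_subset[rotated], use assms(3) in auto)
qed

text \<open>The units of the polynomial ring are the constants.\<close>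

lemma polyf_unit_const:
  assumes "polyf f" "polyf g" "\<And>s. f s * g s = 1"
  shows "f s = f 0"
proof -
  obtain p q where pq: "\<And>s. f s = poly p s" "\<And>s. g s = poly q s"
    using assms(1,2) unfolding polyf_def by blast
  have "p * q = 1"
    by (rule poly_eq_poly_eq_iff[THEN iffD1]) (use assms(3) in \<open>auto simp: pq\<close>)
  then have "is_unit p" by (metis dvdI)
  then obtain c where "p = [:c:]" by (auto simp: is_unit_poly_iff)
  then show ?thesis by (simp add: pq)
qed

section \<open>Curves of matrices with polynomial entries\<close>

definition polycurve :: "(complex \<Rightarrow> complex^'n^'n) \<Rightarrow> bool" where
  "polycurve \<gamma> \<longleftrightarrow> (\<forall>i j. polyf (\<lambda>s. \<gamma> s $ i $ j))"

lemma polycurve_const [intro]: "polycurve (\<lambda>s. A)"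
  by (auto simp: polycurve_def)

lemma polycurve_add [intro]: "polycurve f \<Longrightarrow> polycurve g \<Longrightarrow> polycurve (\<lambda>s. f s + g s)"
  by (auto simp: polycurve_def)

lemma polycurve_diff [intro]: "polycurve f \<Longrightarrow> polycurve g \<Longrightarrow> polycurve (\<lambda>s. f s - g s)"
  by (auto simp: polycurve_def)

lemma polycurve_mult [intro]: "polycurve f \<Longrightarrow> polycurve g \<Longrightarrow> polycurve (\<lambda>s. f s ** g s)"
  by (auto simp: polycurve_def mmult_nth intro!: polyf_sum polyf_mult)

lemma polycurve_smul [intro]: "polyf c \<Longrightarrow> polycurve g \<Longrightarrow> polycurve (\<lambda>s. smul (c s) (g s))"
  by (auto simp: polycurve_def)

lemma polycurve_sum [intro]: "(\<And>x. x \<in> S \<Longrightarrow> polycurve (f x)) \<Longrightarrow> polycurve (\<lambda>s. \<Sum>x\<in>S. f x s)"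
  by (auto simp: polycurve_def intro!: polyf_sum)

lemma polycurve_compose: "polycurve f \<Longrightarrow> polyf g \<Longrightarrow> polycurve (\<lambda>s. f (g s))"
  by (auto simp: polycurve_def intro: polyf_compose)

lemma polycurve_eq_nat:
  assumes "polycurve f" "polycurve g" "\<And>k. f (of_nat k) = g (of_nat k)"
  shows "f s = g s"
proof (rule mat_eqI)
  fix i j
  show "f s $ i $ j = g s $ i $ j"
    by (rule polyf_eq_nat) (use assms(1,2) in \<open>simp_all add: polycurve_def assms(3)\<close>)
qed

lemma polyf_det: "polycurve \<gamma> \<Longrightarrow> polyf (\<lambda>s. det (\<gamma> s))"
  unfolding det_def polycurve_def by (intro polyf_sum polyf_mult polyf_const polyf_prod) auto

text \<open>The determinants of the two curves are mutually inverse polynomials, hence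
  constant.\<close>

lemma polycurve_det_eq_1:
  assumes "polycurve \<gamma>" "polycurve \<delta>" "\<And>s. \<gamma> s ** \<delta> s = mat 1" "\<gamma> 0 = mat 1"
  shows "det (\<gamma> s) = 1"
proof -
  have "det (\<gamma> s) * det (\<delta> s) = 1" for s
    by (metis assms(3) det_I det_mul)
  from polyf_unit_const[OF polyf_det[OF assms(1)] polyf_det[OF assms(2)] this, of s]
  show ?thesis by (simp add: assms(4))
qed

lemma mpow_geometric:
  "(mat 1 - A) ** (\<Sum>j<k. mpow A j) = mat 1 - mpow A k"
  by (induct k) (simp_all add: matrix_add_ldistrib mmult_diff_distrib mpow_Suc2 del: mpow.simps(2))

text \<open>By the finite geometric series the inverse of the line is polynomial in \<open>w\<close>
  as well.\<close>

lemma det_nilpotent_line: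
  assumes "mpow N k = 0"
  shows "det (mat 1 + smul w N) = 1"
proof (rule polycurve_det_eq_1[of "\<lambda>w. mat 1 + smul w N" "\<lambda>w. \<Sum>j<k. smul ((- w) ^ j) (mpow N j)"])
  show "(mat 1 + smul s N) ** (\<Sum>j<k. smul ((- s) ^ j) (mpow N j)) = mat 1" for s
  proof -
    have "mat 1 + smul s N = mat 1 - smul (- s) N"
      by (intro mat_eqI) simp
    then show ?thesis
      using mpow_geometric[of "smul (- s) N" k] assms by (simp add: mpow_smul)
  qed
qed (auto intro!: polycurve_add polycurve_sum polycurve_smul polyf_power simp: polyf_minus)

text \<open>The only generator that could fail to be polynomial along a curve is
  \<open>inverse (det x)\<close>; determinant 1 makes it constant.\<close>

lemma regular_along_polycurve:
  assumes "regular f" "polycurve \<gamma>" "\<And>s. det (\<gamma> s) = 1"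
  shows "polyf (\<lambda>s. f (\<gamma> s))"
  using assms(1)
proof induct
  case (entry i j) then show ?case using assms(2) by (simp add: polycurve_def)
next
  case inv_det then show ?case by (simp add: assms(3))
qed auto

section \<open>Exponentials of nilpotent matrices\<close>

text \<open>The sum is cut off at the index \<open>K\<close>, which is meant to satisfy \<open>mpow X K = 0\<close>.\<close>

definition mexp :: "nat \<Rightarrow> complex^'n^'n \<Rightarrow> complex^'n^'n" where
  "mexp K X = (\<Sum>k<K. smul (inverse (fact k)) (mpow X k))"

lemma mexp_extend:
  assumes "mpow X K = 0" "K \<le> L"
  shows "mexp L X = mexp K X"
proof -
  have "(\<Sum>k<L. smul (inverse (fact k)) (mpow X k)) = (\<Sum>k<K. smul (inverse (fact k)) (mpow X k))"
    by (rule sum.mono_neutral_right)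
       (use assms in \<open>auto simp: mpow_nilpotent_mono not_less\<close>)
  then show ?thesis by (simp add: mexp_def)
qed

lemma mexp_zero: "K > 0 \<Longrightarrow> mexp K (smul 0 X) = mat 1"
proof -
  assume "K > 0"
  then obtain L where K: "K = Suc L" using gr0_implies_Suc by blast
  show ?thesis
    unfolding mexp_def K sum.lessThan_Suc_shift mpow_smul by simp
qed

lemma polycurve_mexp: "polycurve (\<lambda>s. mexp K (smul s X))"
  unfolding mexp_def mpow_smul by (intro polycurve_sum polycurve_smul) auto

text \<open>The Cauchy product of two truncated series; nilpotency kills the terms in which the
  triangle and the square of summation differ.\<close>

lemma mexp_add:
  assumes "mpow X K = 0"
  shows "mexp K (smul (s + t) X) = mexp K (smul s X) ** mexp K (smul t X)"
proof -
  \<comment> \<open>\<open>S x n\<close> is the \<open>n\<close>-th term of the exponential series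
    at \<open>x\<close>; its addition law is the binomial theorem.\<close>
  define S where "S \<equiv> \<lambda>(x::complex) n. x ^ n * inverse (fact n)"
  have S: "S (s + t) n = (\<Sum>i\<le>n. S s i * S t (n - i))" for n
    using exp_series_add_commuting[of s t n]
    by (simp add: S_def scaleR_conv_of_real mult.commute divide_inverse)
  have E: "mexp L (smul x X) = (\<Sum>n<L. smul (S x n) (mpow X n))" for x L
    by (simp add: mexp_def mpow_smul S_def mult.commute)
  let ?g = "\<lambda>i j. smul (S s i * S t j) (mpow X (i + j))"
  \<comment> \<open>At order \<open>2 * K\<close> the triangle contains the square
    \<open>{..<K} \<times> {..<K}\<close>. Outside the square \<open>i + j\<close> is at least
    \<open>K\<close>, so the power of \<open>X\<close> vanishes.\<close>
  have "mexp K (smul (s + t) X) = mexp (2 * K) (smul (s + t) X)"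
    by (rule mexp_extend[symmetric]) (simp_all add: mpow_smul assms)
  also have "\<dots> = (\<Sum>n<2*K. \<Sum>i\<le>n. ?g i (n - i))"
    unfolding E S by (intro sum.cong refl mat_eqI) (simp add: sum_distrib_right)
  also have "\<dots> = (\<Sum>(i, j)\<in>{(i, j). i + j < 2 * K}. ?g i j)"
    by (simp add: sum.triangle_reindex)
  also have "\<dots> = (\<Sum>(i, j)\<in>{..<K} \<times> {..<K}. ?g i j)"
  proof (rule sum.mono_neutral_right)
    show "finite {(i, j). i + j < 2 * K}"
      by (rule finite_subset[of _ "{..<2*K} \<times> {..<2*K}"]) auto
    show "\<forall>p\<in>{(i, j). i + j < 2 * K} - {..<K} \<times> {..<K}. (case p of (i, j) \<Rightarrow> ?g i j) = 0"
    proof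
      fix p assume p: "p \<in> {(i, j). i + j < 2 * K} - {..<K} \<times> {..<K}"
      then have "mpow X (fst p + snd p) = 0"
        by (intro mpow_nilpotent_mono[OF assms]) auto
      then show "(case p of (i, j) \<Rightarrow> ?g i j) = 0" by (simp add: case_prod_beta)
    qed
  qed auto
  also have "\<dots> = mexp K (smul s X) ** mexp K (smul t X)"
    unfolding E mmult_sum_left
    by (simp add: mmult_sum_right sum.cartesian_product[symmetric] mpow_add mult.commute)
  finally show ?thesis .
qed

lemma mexp_minus: 
  assumes "mpow X K = 0" "K > 0"
  shows "mexp K (smul s X) ** mexp K (smul (- s) X) = mat 1"
  using mexp_add[OF assms(1), of s "- s"] mexp_zero[OF assms(2), of X] by simp

lemma det_mexp:
  assumes "mpow X K = 0" "K > 0"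
  shows "det (mexp K (smul s X)) = 1"
proof (rule polycurve_det_eq_1[of "\<lambda>s. mexp K (smul s X)" "\<lambda>s. mexp K (smul (- s) X)"])
  show "polycurve (\<lambda>s. mexp K (smul (- s) X))"
    by (rule polycurve_compose[OF polycurve_mexp]) auto
qed (use mexp_minus[OF assms] mexp_zero[OF assms(2)] polycurve_mexp in auto)

text \<open>Dividing \<open>mexp K (smul s X) - mat 1\<close> by \<open>s\<close> leaves a
  polynomial curve. This is the form in which curves through the identity enter
  \<open>tangent\<close> and \<open>regular_derivation\<close>; \<open>K > 1\<close> makes room for
  the linear term.\<close>

lemma mexp_expansion:
  assumes "K > 1"
  obtains D where "polycurve D" "D 0 = X" "\<And>s. mexp K (smul s X) = mat 1 + smul s (D s)"
proof -
  obtain L where K: "K = Suc (Suc L)" using assms by (cases K; cases "K - 1") auto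
  let ?D = "\<lambda>s. X + (\<Sum>k<L. smul (s ^ Suc k) (smul (inverse (fact (Suc (Suc k)))) (mpow X (Suc (Suc k)))))"
  show ?thesis
  proof
    show "polycurve ?D" by (intro polycurve_add polycurve_sum polycurve_smul polyf_power polycurve_const polyf_id)
    show "?D 0 = X" by simp
    show "mexp K (smul s X) = mat 1 + smul s (?D s)" for s
    proof (rule mat_eqI)
      fix i j
      show "mexp K (smul s X) $ i $ j = (mat 1 + smul s (?D s)) $ i $ j"
        unfolding mexp_def K sum.lessThan_Suc_shift mpow_smul
        by (simp add: sum_distrib_left algebra_simps)
    qed
  qed
qed

section \<open>One-parameter subgroups of closed unipotent groups\<close>

lemma GL_simps [simp]:
  "carrier (GLs H) = H" "x \<otimes>\<^bsub>GLs H\<^esub> y = x ** y" "\<one>\<^bsub>GLs H\<^esub> = mat 1"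
  by (simp_all add: GLs_def mat_monoid_def)

lemma GLs_inv_eq:
  assumes "x \<in> H" "y \<in> H" "x ** y = mat 1"
  shows "inv\<^bsub>GLs H\<^esub> x = (y :: complex^'n^'n)"
  unfolding m_inv_def
proof (rule the_equality)
  show "y \<in> carrier (GLs H) \<and> x \<otimes>\<^bsub>GLs H\<^esub> y = \<one>\<^bsub>GLs H\<^esub> \<and> y \<otimes>\<^bsub>GLs H\<^esub> x = \<one>\<^bsub>GLs H\<^esub>"
    using assms matrix_left_right_inverse1 by simp
  show "z = y" if "z \<in> carrier (GLs H) \<and> x \<otimes>\<^bsub>GLs H\<^esub> z = \<one>\<^bsub>GLs H\<^esub> \<and> z \<otimes>\<^bsub>GLs H\<^esub> x = \<one>\<^bsub>GLs H\<^esub>" for z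
    using that assms(3) matrix_inv_eqI by (metis GL_simps(2,3))
qed

lemma alg_groupD:
  assumes "alg_group (H :: (complex^'n^'n) set)"
  shows "mat 1 \<in> H" "x \<in> H \<Longrightarrow> y \<in> H \<Longrightarrow> x ** y \<in> H" "x \<in> H \<Longrightarrow> invertible x"
    "x \<in> H \<Longrightarrow> matrix_inv x \<in> H"
proof -
  have sub: "subgroup H GL" using assms by (simp add: alg_group_def)
  show "mat 1 \<in> H" using subgroup.one_closed[OF sub] by simp
  show "x ** y \<in> H" if "x \<in> H" "y \<in> H" using subgroup.m_closed[OF sub that] by simp
  show inv: "invertible x" if "x \<in> H" for x using subgroup.subset[OF sub] that by auto
  show "matrix_inv x \<in> H" if "x \<in> H"
  proof -
    have "invertible (matrix_inv x)"
      using matrix_inv_mult[OF inv[OF that]] unfolding invertible_def by blast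
    then have "inv\<^bsub>GL\<^esub> x = matrix_inv x"
      using inv[OF that] by (intro GLs_inv_eq matrix_inv_mult) auto
    then show ?thesis using subgroup.m_inv_closed[OF sub that] by simp
  qed
qed

lemma alg_group_normal_conj:
  assumes "alg_group B" "normal U (GLs B)" "b \<in> B" "u \<in> U"
  shows "b ** u ** matrix_inv b \<in> U"
  using normal.inv_op_closed2[OF assms(2), of b u] assms
  by (simp add: GLs_inv_eq[of b B "matrix_inv b"] alg_groupD matrix_inv_mult)

text \<open>Each defining equation becomes a polynomial in \<open>s\<close> that vanishes at all
  natural numbers.\<close>

lemma curve_in_zariski_closed:
  assumes "zariski_closed V" "polycurve \<gamma>" "\<And>s. det (\<gamma> s) = 1" "\<And>k. \<gamma> (of_nat k) \<in> V"
  shows "\<gamma> s \<in> V"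
proof -
  obtain F where F: "\<And>f. f \<in> F \<Longrightarrow> regular f" "V = {x. invertible x \<and> (\<forall>f\<in>F. f x = 0)}"
    using assms(1) unfolding zariski_closed_def by blast
  have "f (\<gamma> s) = 0" if "f \<in> F" for f
    by (rule polyf_eq_nat[OF regular_along_polycurve[OF F(1)[OF that] assms(2,3)]])
       (use assms(4) that in \<open>auto simp: F(2)\<close>)
  then show ?thesis by (simp add: F(2) invertible_det_nz assms(3))
qed

text \<open>The range of summation does not depend on \<open>k\<close>, so the right-hand side makes
  sense, and is polynomial, for a complex exponent.\<close>

lemma mpow_binomial:
  assumes "mpow N (Suc L) = 0"
  shows "mpow (mat 1 + N) k = (\<Sum>j<Suc L. smul (of_nat (k choose j)) (mpow N j))"
proof (induct k)
  case 0
  show ?case unfolding sum.lessThan_Suc_shift by simp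
next
  case (Suc k)
  let ?S = "\<Sum>j<Suc L. smul (of_nat (k choose j)) (mpow N j)"
  have "?S ** N = (\<Sum>j<Suc L. smul (of_nat (k choose j)) (mpow N (Suc j)))"
    unfolding mmult_sum_left by (intro sum.cong) simp_all
  also have "\<dots> = (\<Sum>j<L. smul (of_nat (k choose j)) (mpow N (Suc j)))"
    unfolding sum.lessThan_Suc assms by simp
  finally have "?S + ?S ** N = mat 1 + (\<Sum>j<L. smul (of_nat (k choose Suc j)) (mpow N (Suc j))
      + smul (of_nat (k choose j)) (mpow N (Suc j)))"
    unfolding sum.lessThan_Suc_shift sum.distrib by simp
  also have "\<dots> = (\<Sum>j<Suc L. smul (of_nat (Suc k choose j)) (mpow N j))"
    unfolding sum.lessThan_Suc_shift by (simp add: smul_add add.commute)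
  finally show ?case by (simp only: Suc mpow.simps matrix_add_ldistrib matrix_mul_rid)
qed

lemma unipotent_iff: "unipotent u \<longleftrightarrow> (\<exists>k. mpow (u - mat 1) k = 0)"
  by (simp add: unipotent_def mat_monoid_pow)

lemma polyf_gchoose: "polyf (\<lambda>s. s gchoose j)"
  unfolding gbinomial_prod_rev divide_inverse by (intro polyf_mult polyf_prod polyf_diff) auto

lemma mpow_in_alg_group: "alg_group V \<Longrightarrow> u \<in> V \<Longrightarrow> mpow u k \<in> V"
  by (induct k) (auto simp: alg_groupD)

text \<open>The curve consists of the complex powers of \<open>u\<close>: a complex number replaces
  \<open>k\<close> in the binomial formula. The group law and membership in \<open>V\<close> hold at
  natural numbers and extend by polynomiality.\<close>

lemma unipotent_one_parameter:
  assumes "alg_group V" "u \<in> V" "unipotent u"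
  obtains \<gamma> where "polycurve \<gamma>" "\<And>s t. \<gamma> (s + t) = \<gamma> s ** \<gamma> t" "\<gamma> 0 = mat 1" "\<gamma> 1 = u"
    "\<And>s. \<gamma> s \<in> V"
proof -
  obtain k where "mpow (u - mat 1) k = 0" using assms(3) by (auto simp: unipotent_iff)
  then have K: "mpow (u - mat 1) (Suc k) = 0" by simp
  define \<gamma> where "\<gamma> s = (\<Sum>j<Suc k. smul (s gchoose j) (mpow (u - mat 1) j))" for s
  have pc: "polycurve \<gamma>"
    unfolding \<gamma>_def by (intro polycurve_sum polycurve_smul polyf_gchoose polycurve_const)
  have nat: "\<gamma> (of_nat k) = mpow u k" for k
    using mpow_binomial[OF K, of k] by (simp add: \<gamma>_def binomial_gbinomial del: sum.lessThan_Suc)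
  have shift: "polycurve (\<lambda>s. \<gamma> (s + t))" for t
    by (rule polycurve_compose[OF pc]) auto
  have "\<gamma> (of_nat k + of_nat l) = \<gamma> (of_nat k) ** \<gamma> (of_nat l)" for k l
    unfolding of_nat_add[symmetric] nat by (rule mpow_add)
  \<comment> \<open>The group law is extended in one variable at a time.\<close>
  then have "\<gamma> (s + of_nat l) = \<gamma> s ** \<gamma> (of_nat l)" for s l
    by (rule polycurve_eq_nat[OF shift polycurve_mult[OF pc polycurve_const]])
  then have "\<gamma> (of_nat l + s) = \<gamma> s ** \<gamma> (of_nat l)" for s l by (simp add: add.commute)
  then have "\<gamma> (t + s) = \<gamma> s ** \<gamma> t" for s t
    by (rule polycurve_eq_nat[OF shift polycurve_mult[OF polycurve_const pc]])
  then have hom: "\<gamma> (s + t) = \<gamma> s ** \<gamma> t" for s t by (metis add.commute)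
  have 0: "\<gamma> 0 = mat 1" using nat[of 0] by simp
  have "det (\<gamma> s) = 1" for s
  proof (rule polycurve_det_eq_1[OF pc _ _ 0])
    show "polycurve (\<lambda>s. \<gamma> (- s))" by (rule polycurve_compose[OF pc]) auto
    show "\<gamma> s ** \<gamma> (- s) = mat 1" for s using hom[of s "- s"] 0 by simp
  qed
  moreover have "\<gamma> (of_nat k) \<in> V" for k
    unfolding nat by (rule mpow_in_alg_group[OF assms(1,2)])
  moreover have "zariski_closed V" using assms(1) by (simp add: alg_group_def)
  ultimately have "\<gamma> s \<in> V" for s by (metis curve_in_zariski_closed[OF _ pc])
  with that pc hom 0 nat[of 1] show ?thesis by simp
qed

text \<open>Differentiating the group law at \<open>t = 0\<close> gives
  \<open>\<gamma>' = \<gamma> X\<close> with \<open>X\<close> the velocity at 0; comparing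
  coefficients turns this into the recursion of the exponential series.\<close>

lemma one_parameter_eq_mexp:
  assumes pc: "polycurve \<gamma>" and hom: "\<And>s t. \<gamma> (s + t) = \<gamma> s ** \<gamma> t" and one: "\<gamma> 0 = mat 1"
  obtains X K where "K > 1" "mpow X K = 0" "\<And>s. \<gamma> s = mexp K (smul s X)"
proof -
  obtain p where p: "\<And>i j s. \<gamma> s $ i $ j = poly (p i j) s"
    using pc unfolding polycurve_def polyf_def by metis
  define X where "X = (\<chi> i j. coeff (p i j) 1)"
  have der: "pderiv (p i j) = (\<Sum>l\<in>UNIV. smult (X $ l $ j) (p i l))" for i j
  proof (rule poly_eq_poly_eq_iff[THEN iffD1], rule ext)
    fix s
    have "((\<lambda>t. poly (p i j) (s + t)) has_field_derivative poly (pderiv (p i j)) (s + 0)) (at 0)"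
      by (rule DERIV_chain'[where g = "poly (p i j)" and D = 1, simplified])
         (auto intro!: derivative_eq_intros poly_DERIV)
    moreover have "(\<lambda>t. poly (p i j) (s + t)) = (\<lambda>t. \<Sum>l\<in>UNIV. poly (p i l) s * poly (p l j) t)"
      by (simp add: p[symmetric] hom mmult_nth)
    moreover have "((\<lambda>t. \<Sum>l\<in>UNIV. poly (p i l) s * poly (p l j) t) has_field_derivative
        (\<Sum>l\<in>UNIV. poly (p i l) s * poly (pderiv (p l j)) 0)) (at 0)"
      by (intro DERIV_sum DERIV_cmult poly_DERIV)
    ultimately have "poly (pderiv (p i j)) s = (\<Sum>l\<in>UNIV. poly (p i l) s * poly (pderiv (p l j)) 0)"
      by (metis (no_types, lifting) DERIV_unique add.right_neutral)
    then show "poly (pderiv (p i j)) s = poly (\<Sum>l\<in>UNIV. smult (X $ l $ j) (p i l)) s"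
      by (simp add: poly_sum X_def poly_0_coeff_0 coeff_pderiv mult.commute)
  qed
  have coeff: "coeff (p i j) k = inverse (fact k) * mpow X k $ i $ j" for i j k
  proof (induct k arbitrary: i j)
    case 0
    have "coeff (p i j) 0 = \<gamma> 0 $ i $ j" by (simp add: p poly_0_coeff_0)
    then show ?case by (simp add: one)
  next
    case (Suc k)
    have "of_nat (Suc k) * coeff (p i j) (Suc k) = (\<Sum>l\<in>UNIV. X $ l $ j * coeff (p i l) k)"
      using arg_cong[OF der[of i j], of "\<lambda>q. coeff q k"] by (simp add: coeff_pderiv coeff_sum)
    also have "\<dots> = inverse (fact k) * mpow X (Suc k) $ i $ j"
      by (simp add: Suc mmult_nth sum_distrib_left algebra_simps)
    finally show ?case
      by (simp add: field_simps del: mpow.simps of_nat_Suc)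
  qed
  \<comment> \<open>\<open>K\<close> exceeds the degree of every entry, so the coefficients of index
    \<open>K\<close>, which are the entries of \<open>mpow X K\<close> up to a factorial, vanish.
    The second \<open>Suc\<close> secures \<open>K > 1\<close>.\<close>
  define K where "K = Suc (Suc (\<Sum>i\<in>UNIV. \<Sum>j\<in>UNIV. degree (p i j)))"
  have deg: "degree (p i j) < K" for i j
  proof -
    have "degree (p i j) \<le> (\<Sum>j\<in>UNIV. degree (p i j))" by (rule member_le_sum) auto
    also have "\<dots> \<le> (\<Sum>i\<in>UNIV. \<Sum>j\<in>UNIV. degree (p i j))"
      by (rule member_le_sum[of i UNIV "\<lambda>i. \<Sum>j\<in>UNIV. degree (p i j)"]) auto
    finally show ?thesis by (simp add: K_def)
  qed
  have "mpow X K = 0"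
  proof (rule mat_eqI)
    fix i j
    show "mpow X K $ i $ j = 0 $ i $ j"
      using coeff[of i j K] coeff_eq_0[OF deg[of i j]] by simp
  qed
  moreover have "\<gamma> s = mexp K (smul s X)" for s
  proof (rule mat_eqI)
    fix i j
    have "poly (p i j) s = (\<Sum>k<K. coeff (p i j) k * s ^ k)"
      unfolding poly_altdef using deg[of i j]
      by (intro sum.mono_neutral_left) (auto simp: coeff_eq_0)
    then show "\<gamma> s $ i $ j = mexp K (smul s X) $ i $ j"
      by (simp add: p mexp_def mpow_smul coeff algebra_simps)
  qed
  moreover have "K > 1" by (simp add: K_def)
  ultimately show ?thesis using that by blast
qed

text \<open>Velocities at the identity of polynomial curves in \<open>V\<close>. Writing the curve
  as \<open>mat 1 + smul s (D s)\<close> makes the velocity the value \<open>D 0\<close>, without a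
  derivative.\<close>

definition tangent :: "(complex^'n^'n) set \<Rightarrow> complex^'n^'n \<Rightarrow> bool" where
  "tangent V X \<longleftrightarrow> (\<exists>D. polycurve D \<and> D 0 = X \<and> (\<forall>s. mat 1 + smul s (D s) \<in> V))"

text \<open>Velocities add up when the two curves are multiplied.\<close>

lemma tangent_add:
  assumes "alg_group V" "tangent V X" "tangent V Y"
  shows "tangent V (X + Y)"
proof -
  obtain D E where DE: "polycurve D" "D 0 = X" "\<And>s. mat 1 + smul s (D s) \<in> V"
     "polycurve E" "E 0 = Y" "\<And>s. mat 1 + smul s (E s) \<in> V"
    using assms(2,3) unfolding tangent_def by blast
  have "mat 1 + smul s (D s + E s + smul s (D s ** E s)) = (mat 1 + smul s (D s)) ** (mat 1 + smul s (E s))" for s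
    by (simp add: mmult_add_rdistrib matrix_add_ldistrib smul_add)
  then have "mat 1 + smul s (D s + E s + smul s (D s ** E s)) \<in> V" for s
    using DE assms(1) by (simp add: alg_groupD)
  moreover have "polycurve (\<lambda>s. D s + E s + smul s (D s ** E s))"
    by (intro polycurve_add polycurve_smul polycurve_mult polyf_id DE)
  ultimately show ?thesis
    unfolding tangent_def using DE(2,5)
    by (intro exI[of _ "\<lambda>s. D s + E s + smul s (D s ** E s)"]) simp
qed

lemma tangent_smul:
  assumes "tangent V X"
  shows "tangent V (smul c X)"
proof -
  obtain D where D: "polycurve D" "D 0 = X" "\<And>s. mat 1 + smul s (D s) \<in> V"
    using assms(1) unfolding tangent_def by blast
  show ?thesis
    unfolding tangent_def
  proof (intro exI conjI allI)
    have "polycurve (\<lambda>s. D (c * s))" by (rule polycurve_compose[OF D(1)]) auto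
    then show "polycurve (\<lambda>s. smul c (D (c * s)))"
      by (intro polycurve_smul polyf_const)
    show "mat 1 + smul s (smul c (D (c * s))) \<in> V" for s
      using D(3)[of "c * s"] by (simp add: mult.commute)
  qed (simp add: D)
qed

lemma tangent_conj:
  assumes "tangent V X" "invertible g" "\<And>v. v \<in> V \<Longrightarrow> g ** v ** matrix_inv g \<in> V"
  shows "tangent V (g ** X ** matrix_inv g)"
proof -
  obtain D where D: "polycurve D" "D 0 = X" "\<And>s. mat 1 + smul s (D s) \<in> V"
    using assms(1) unfolding tangent_def by blast
  have "mat 1 + smul s (g ** D s ** matrix_inv g) = g ** (mat 1 + smul s (D s)) ** matrix_inv g" for s
    by (simp add: matrix_add_ldistrib mmult_add_rdistrib matrix_inv_mult[OF assms(2)])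
  moreover have "polycurve (\<lambda>s. g ** D s ** matrix_inv g)"
    by (intro polycurve_mult polycurve_const D)
  ultimately show ?thesis
    using D assms(3) unfolding tangent_def by (intro exI[of _ "\<lambda>s. g ** D s ** matrix_inv g"]) simp
qed

text \<open>The inverse of \<open>mat 1 - smul z X\<close> is the geometric series, with coefficient
  \<open>mpow X k\<close> at the \<open>k\<close>-th power of \<open>z\<close>; a polynomial has
  only finitely many nonzero coefficients.\<close>

lemma nilpotent_if_polycurve_inverse:
  assumes "polycurve B" "\<And>z. (mat 1 - smul z X) ** B z = mat 1"
  obtains K where "mpow X K = 0"
proof -
  obtain p where p: "\<And>i j s. B s $ i $ j = poly (p i j) s"
    using assms(1) unfolding polycurve_def polyf_def by metis
  have eq: "p i j = [:mat 1 $ i $ j:] + pCons 0 (\<Sum>l\<in>UNIV. smult (X $ i $ l) (p l j))" for i j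
  proof (rule poly_eq_poly_eq_iff[THEN iffD1], rule ext)
    fix s
    have "B s = mat 1 + smul s (X ** B s)"
      using assms(2)[of s] by (simp add: mmult_diff_distrib algebra_simps)
    then have "B s $ i $ j = (mat 1 + smul s (X ** B s)) $ i $ j" by metis
    then show "poly (p i j) s = poly ([:mat 1 $ i $ j:] + pCons 0 (\<Sum>l\<in>UNIV. smult (X $ i $ l) (p l j))) s"
      by (simp add: p mmult_nth poly_sum)
  qed
  have coeff: "coeff (p i j) k = mpow X k $ i $ j" for i j k
  proof (induct k arbitrary: i j)
    case 0
    show ?case by (subst eq) simp
  next
    case (Suc k)
    show ?case by (subst eq) (simp add: Suc mpow_Suc2 mmult_nth coeff_sum del: mpow.simps)
  qed
  define K where "K = Suc (\<Sum>i\<in>UNIV. \<Sum>j\<in>UNIV. degree (p i j))"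
  have "mpow X K = 0"
  proof (rule mat_eqI)
    fix i j
    have "degree (p i j) \<le> (\<Sum>j\<in>UNIV. degree (p i j))" by (rule member_le_sum) auto
    also have "\<dots> \<le> (\<Sum>i\<in>UNIV. \<Sum>j\<in>UNIV. degree (p i j))"
      by (rule member_le_sum[of i UNIV "\<lambda>i. \<Sum>j\<in>UNIV. degree (p i j)"]) auto
    finally show "mpow X K $ i $ j = 0 $ i $ j"
      using coeff[of i j K] coeff_eq_0[of "p i j" K] by (simp add: K_def)
  qed
  then show ?thesis by (rule that)
qed

text \<open>Cramer's rule; determinant 1 leaves no denominator.\<close>

lemma polycurve_inverse:
  assumes "polycurve A" "\<And>z. det (A z) = 1"
  obtains B where "polycurve B" "\<And>z. A z ** B z = mat 1"
proof
  let ?C = "\<lambda>z k j. \<chi> a b. if b = k then mat 1 $ a $ j else A z $ a $ b"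
  let ?B = "\<lambda>z. \<chi> k j. det (?C z k j)"
  have "polyf (\<lambda>z. ?C z k j $ a $ b)" for k j a b
    using assms(1) by (cases "b = k") (simp_all add: polycurve_def)
  then have "polycurve (\<lambda>z. ?C z k j)" for k j
    by (simp add: polycurve_def)
  then show "polycurve ?B" by (simp add: polycurve_def polyf_det)
  show "A z ** ?B z = mat 1" for z
  proof (rule mat_eqI)
    fix i j
    have "det (A z) \<noteq> 0" by (simp add: assms(2))
    from cramer[OF this, THEN iffD2, OF refl, of "\<chi> a. mat 1 $ a $ j"]
    have "A z *v (\<chi> k. det (?C z k j) / det (A z)) = (\<chi> a. mat 1 $ a $ j)"
      unfolding vec_lambda_beta .
    from arg_cong[OF this, of "\<lambda>v. v $ i"]
    show "(A z ** ?B z) $ i $ j = mat 1 $ i $ j"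
      by (simp add: matrix_vector_mult_def mmult_nth assms(2))
  qed
qed

text \<open>For \<open>s\<close> nonzero, \<open>D s\<close> is nilpotent because
  \<open>mat 1 + smul s (D s)\<close> is unipotent, so \<open>mat 1 + smul z (D s)\<close> has
  determinant 1; this persists at \<open>s = 0\<close>, where \<open>D 0 = X\<close>. Hence the line
  \<open>mat 1 - smul z X\<close> has a polynomial inverse.\<close>

lemma tangent_nilpotent:
  assumes "\<And>u. u \<in> V \<Longrightarrow> unipotent u" "tangent V X"
  obtains K where "mpow X K = 0"
proof -
  obtain D where D: "polycurve D" "D 0 = X" "\<And>s. mat 1 + smul s (D s) \<in> V"
    using assms(2) unfolding tangent_def by blast
  have "det (mat 1 + smul z X) = 1" for z
  proof -
    have "polyf (\<lambda>s. det (mat 1 + smul z (D s)))"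
      by (intro polyf_det polycurve_add polycurve_smul polycurve_const polyf_const D)
    then have "det (mat 1 + smul z (D 0)) = 1"
    proof (rule polyf_eq_nonzero[where f = "\<lambda>s. det (mat 1 + smul z (D s))"])
      fix s :: complex
      assume "s \<noteq> 0"
      have "unipotent (mat 1 + smul s (D s))" by (rule assms(1)[OF D(3)])
      then obtain k where "mpow (smul s (D s)) k = 0" by (auto simp: unipotent_iff)
      from det_nilpotent_line[OF this, of "z / s"] \<open>s \<noteq> 0\<close>
      show "det (mat 1 + smul z (D s)) = 1" by simp
    qed auto
    then show ?thesis by (simp add: D(2))
  qed
  moreover have "mat 1 - smul z X = mat 1 + smul (- z) X" for z
    by (rule mat_eqI) simp
  ultimately have det: "det (mat 1 - smul z X) = 1" for z by metis
  have "polycurve (\<lambda>z. mat 1 - smul z X)"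
    by (intro polycurve_diff polycurve_smul polycurve_const polyf_id)
  from polycurve_inverse[OF this det]
  obtain B where B: "polycurve B" "\<And>z. (mat 1 - smul z X) ** B z = mat 1" by blast
  from nilpotent_if_polycurve_inverse[OF this] that show ?thesis by blast
qed

section \<open>Derivations of regular functions, and logarithms in a closed unipotent group\<close>

lemma regular_sum: "(\<And>x. x \<in> S \<Longrightarrow> regular (f x)) \<Longrightarrow> regular (\<lambda>y. \<Sum>x\<in>S. f x y)"
  by (induct S rule: infinite_finite_induct) (auto intro: regular.intros)

lemma regular_prod: "(\<And>x. x \<in> S \<Longrightarrow> regular (f x)) \<Longrightarrow> regular (\<lambda>y. \<Prod>x\<in>S. f x y)"
  by (induct S rule: infinite_finite_induct) (auto intro: regular.intros)

lemma polyf_has_derivative_at_0: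
  assumes "polyf h"
  shows "((\<lambda>s. s * h s) has_field_derivative h 0) (at 0)"
proof -
  obtain p where p: "h = poly p" using assms unfolding polyf_def by blast
  show ?thesis unfolding p by (auto intro!: derivative_eq_intros poly_DERIV)
qed

text \<open>The derivative along \<open>X\<close> depends only on the first-order term of the curve, so the curves
  in \<open>V\<close> that witness tangency may be exchanged for the exponential curve.\<close>

lemma regular_derivation:
  fixes X :: "complex^'n^'n"
  assumes "regular f"
  shows "\<exists>g. regular g \<and> (\<forall>D x. polycurve D \<longrightarrow> D 0 = X \<longrightarrow> (\<forall>s. det (mat 1 + smul s (D s)) = 1) \<longrightarrow>
     ((\<lambda>s. f (x ** (mat 1 + smul s (D s)))) has_field_derivative g x) (at 0))"
  using assms
proof induct
  case (const z)
  show ?case by (rule exI[of _ "\<lambda>x. 0"]) (auto intro: regular.intros)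
next
  case (entry i j)
  show ?case
  proof (intro exI conjI allI impI)
    show "regular (\<lambda>x. \<Sum>k\<in>UNIV. x $ i $ k * X $ k $ j)"
      by (intro regular_sum regular.intros)
    fix D :: "complex \<Rightarrow> complex^'n^'n" and x :: "complex^'n^'n"
    assume D: "polycurve D" "D 0 = X"
    have eq: "(x ** (mat 1 + smul s (D s))) $ i $ j = x $ i $ j + s * (\<Sum>k\<in>UNIV. x $ i $ k * D s $ k $ j)" for s
      by (simp add: matrix_add_ldistrib mmult_nth)
    have "polyf (\<lambda>s. \<Sum>k\<in>UNIV. x $ i $ k * D s $ k $ j)"
      using D(1) by (auto simp: polycurve_def intro!: polyf_sum polyf_mult)
    from DERIV_add[OF DERIV_const polyf_has_derivative_at_0[OF this], of "x $ i $ j"]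
    show "((\<lambda>s. (x ** (mat 1 + smul s (D s))) $ i $ j) has_field_derivative
        (\<Sum>k\<in>UNIV. x $ i $ k * X $ k $ j)) (at 0)"
      unfolding eq by (simp add: D(2))
  qed
next
  \<comment> \<open>The factor \<open>mat 1 + smul s (D s)\<close> has determinant 1, so this
    function is constant along the curve.\<close>
  case inv_det
  show ?case
    by (rule exI[of _ "\<lambda>x. 0"]) (auto intro: regular.intros simp: det_mul)
next
  case (add f1 f2)
  then obtain g1 g2 where "regular g1" "regular g2"
    "\<And>D x. polycurve D \<Longrightarrow> D 0 = X \<Longrightarrow> (\<forall>s. det (mat 1 + smul s (D s)) = 1) \<Longrightarrow>
     ((\<lambda>s. f1 (x ** (mat 1 + smul s (D s)))) has_field_derivative g1 x) (at 0)"
    "\<And>D x. polycurve D \<Longrightarrow> D 0 = X \<Longrightarrow> (\<forall>s. det (mat 1 + smul s (D s)) = 1) \<Longrightarrow>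
     ((\<lambda>s. f2 (x ** (mat 1 + smul s (D s)))) has_field_derivative g2 x) (at 0)"
    by blast
  then show ?case
    by (intro exI[of _ "\<lambda>x. g1 x + g2 x"]) (auto intro: regular.intros DERIV_add)
next
  case (mult f1 f2)
  then obtain g1 g2 where g: "regular g1" "regular g2"
    "\<And>D x. polycurve D \<Longrightarrow> D 0 = X \<Longrightarrow> (\<forall>s. det (mat 1 + smul s (D s)) = 1) \<Longrightarrow>
     ((\<lambda>s. f1 (x ** (mat 1 + smul s (D s)))) has_field_derivative g1 x) (at 0)"
    "\<And>D x. polycurve D \<Longrightarrow> D 0 = X \<Longrightarrow> (\<forall>s. det (mat 1 + smul s (D s)) = 1) \<Longrightarrow>
     ((\<lambda>s. f2 (x ** (mat 1 + smul s (D s)))) has_field_derivative g2 x) (at 0)"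
    by blast
  show ?case
  proof (intro exI conjI allI impI)
    show "regular (\<lambda>x. g1 x * f2 x + g2 x * f1 x)"
      using mult g by (intro regular.intros)
    fix D x
    assume "polycurve D" "D 0 = X" "\<forall>s. det (mat 1 + smul s (D s)) = 1"
    from DERIV_mult[OF g(3)[OF this, of x] g(4)[OF this, of x]]
    show "((\<lambda>s. f1 (x ** (mat 1 + smul s (D s))) * f2 (x ** (mat 1 + smul s (D s)))) has_field_derivative
       (g1 x * f2 x + g2 x * f1 x)) (at 0)" by simp
  qed
qed

text \<open>If \<open>f\<close> vanishes on \<open>V\<close>, so does its derivative along
  \<open>X\<close>, computed with the curve in \<open>V\<close>. Computed with the exponential
  curve, the same derivative is that of the polynomial
  \<open>s \<mapsto> f (mexp K (smul s X))\<close>. By iteration all Taylor coefficients of this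
  polynomial at 0 vanish.\<close>

lemma tangent_mexp:
  assumes alg: "alg_group V" and unip: "\<And>u. u \<in> V \<Longrightarrow> unipotent u"
    and X: "tangent V X" and K: "mpow X K = 0" "K > 1"
  shows "mexp K (smul s X) \<in> V"
proof -
  obtain D where D: "polycurve D" "D 0 = X" "\<And>s. mat 1 + smul s (D s) \<in> V"
    using X unfolding tangent_def by blast
  have detD: "det (mat 1 + smul s (D s)) = 1" for s
  proof -
    obtain k where "mpow (smul s (D s)) k = 0"
      using unip[OF D(3)[of s]] by (auto simp: unipotent_iff)
    from det_nilpotent_line[OF this, of 1] show ?thesis by simp
  qed
  obtain E where E: "polycurve E" "E 0 = X" "\<And>s. mexp K (smul s X) = mat 1 + smul s (E s)"
    using mexp_expansion[OF K(2)] by metis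
  have det: "det (mexp K (smul s X)) = 1" for s using det_mexp[OF K(1)] K(2) by simp
  \<comment> \<open>Induction on \<open>n\<close> for all \<open>f\<close> at once: \<open>f\<close>
    is replaced by its derivative \<open>g\<close>, and \<open>p\<close> by
    \<open>pderiv p\<close>.\<close>
  have zero: "coeff p n = 0"
    if "regular f" "\<And>v. v \<in> V \<Longrightarrow> f v = 0" "\<And>s. f (mexp K (smul s X)) = poly p s" for f p n
    using that
  proof (induct n arbitrary: f p)
    case 0
    then have "poly p 0 = 0"
      using mexp_zero[of K X] K alg by (metis alg_groupD(1) less_trans zero_less_one)
    then show ?case by (simp add: poly_0_coeff_0)
  next
    case (Suc n)
    obtain g where g: "regular g" "\<And>D x. polycurve D \<Longrightarrow> D 0 = X \<Longrightarrow> (\<forall>s. det (mat 1 + smul s (D s)) = 1) \<Longrightarrow>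
       ((\<lambda>s. f (x ** (mat 1 + smul s (D s)))) has_field_derivative g x) (at 0)"
      using regular_derivation[OF Suc.prems(1), of X] by blast
    have "g v = 0" if "v \<in> V" for v
    proof -
      have "((\<lambda>s. f (v ** (mat 1 + smul s (D s)))) has_field_derivative g v) (at 0)"
        by (rule g(2)) (use D detD in auto)
      moreover have "(\<lambda>s. f (v ** (mat 1 + smul s (D s)))) = (\<lambda>s. 0)"
        using Suc.prems(2) D(3) alg_groupD(2)[OF alg that] by blast
      ultimately show ?thesis by (metis DERIV_const DERIV_unique)
    qed
    moreover have "g (mexp K (smul s X)) = poly (pderiv p) s" for s
    proof -
      have "((\<lambda>t. f (mexp K (smul s X) ** (mat 1 + smul t (E t)))) has_field_derivative g (mexp K (smul s X))) (at 0)"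
        by (rule g(2)) (use E det in auto)
      moreover have "(\<lambda>t. f (mexp K (smul s X) ** (mat 1 + smul t (E t)))) = (\<lambda>t. poly p (s + t))"
        unfolding E(3)[symmetric] mexp_add[OF K(1), symmetric] Suc.prems(3) ..
      moreover have "((\<lambda>t. poly p (s + t)) has_field_derivative poly (pderiv p) (s + 0)) (at 0)"
        by (rule DERIV_chain'[where g = "poly p" and D = 1, simplified])
           (auto intro!: derivative_eq_intros poly_DERIV)
      ultimately show ?thesis by (metis DERIV_unique add.right_neutral)
    qed
    ultimately have "coeff (pderiv p) n = 0" by (intro Suc.hyps[OF g(1)])
    then show ?case by (simp add: coeff_pderiv del: of_nat_Suc)
  qed
  obtain F where F: "\<And>f. f \<in> F \<Longrightarrow> regular f" "V = {x. invertible x \<and> (\<forall>f\<in>F. f x = 0)}"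
    using alg unfolding alg_group_def zariski_closed_def by blast
  have "f (mexp K (smul s X)) = 0" if f: "f \<in> F" for f
  proof -
    obtain p where p: "\<And>s. f (mexp K (smul s X)) = poly p s"
      using regular_along_polycurve[OF F(1)[OF f] polycurve_mexp det] unfolding polyf_def by blast
    have "p = 0"
      by (rule poly_eqI) (use zero[OF F(1)[OF f] _ p] f in \<open>simp add: F(2)\<close>)
    then show ?thesis by (simp add: p)
  qed
  then show ?thesis by (simp add: F(2) invertible_det_nz det)
qed

text \<open>The logarithm of \<open>u\<close> is the velocity of the one-parameter subgroup through
  \<open>u\<close>.\<close>

lemma unipotent_group_log:
  assumes "alg_group V" "\<And>u. u \<in> V \<Longrightarrow> unipotent u" "u \<in> V"
  obtains X K where "K > 1" "mpow X K = 0" "tangent V X" "u = mexp K X"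
proof -
  obtain \<gamma> where \<gamma>: "polycurve \<gamma>" "\<And>s t. \<gamma> (s + t) = \<gamma> s ** \<gamma> t" "\<gamma> 0 = mat 1" "\<gamma> 1 = u"
    "\<And>s. \<gamma> s \<in> V"
    using unipotent_one_parameter[OF assms(1,3) assms(2)[OF assms(3)]] by metis
  obtain X K where X: "K > 1" "mpow X K = 0" "\<And>s. \<gamma> s = mexp K (smul s X)"
    using one_parameter_eq_mexp[OF \<gamma>(1,2,3)] by metis
  obtain E where E: "polycurve E" "E 0 = X" "\<And>s. mexp K (smul s X) = mat 1 + smul s (E s)"
    using mexp_expansion[OF X(1)] by metis
  have "tangent V X" unfolding tangent_def using E \<gamma>(5) X(3) by metis
  moreover have "u = mexp K X" using \<gamma>(4) X(3)[of 1] by simp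
  ultimately show ?thesis using that X by blast
qed

section \<open>Nonnegative combinations of characters\<close>

definition char_mono :: "('r::finite \<Rightarrow> 'a \<Rightarrow> complex) \<Rightarrow> ('r \<Rightarrow> nat) \<Rightarrow> 'a \<Rightarrow> complex" where
  "char_mono \<alpha> m t = (\<Prod>i\<in>UNIV. \<alpha> i t ^ m i)"

lemma char_mono_zero [simp]: "char_mono \<alpha> (\<lambda>i. 0) t = 1"
  by (simp add: char_mono_def)

lemma char_mono_add: "char_mono \<alpha> (\<lambda>i. m i + m' i) t = char_mono \<alpha> m t * char_mono \<alpha> m' t"
  by (simp add: char_mono_def power_add prod.distrib)

lemma char_mono_single: "char_mono \<alpha> (\<lambda>j. if j = i then 1 else 0) t = \<alpha> i t"
proof -
  have "char_mono \<alpha> (\<lambda>j. if j = i then 1 else 0) t = (\<Prod>j\<in>UNIV. if j = i then \<alpha> i t else 1)"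
    unfolding char_mono_def by (intro prod.cong) auto
  then show ?thesis by simp
qed

text \<open>The span of the monomials of degree at least \<open>d\<close>, as functions on
  \<open>T\<close>. Terms are added one at a time, so that closure properties follow by rule
  induction.\<close>

inductive poscomb :: "'a set \<Rightarrow> ('r::finite \<Rightarrow> 'a \<Rightarrow> complex) \<Rightarrow> nat \<Rightarrow> ('a \<Rightarrow> complex) \<Rightarrow> bool"
  for T \<alpha> d where
  zero: "(\<And>t. t \<in> T \<Longrightarrow> g t = 0) \<Longrightarrow> poscomb T \<alpha> d g"
| step: "poscomb T \<alpha> d g \<Longrightarrow> d \<le> sum m UNIV \<Longrightarrow>
    (\<And>t. t \<in> T \<Longrightarrow> f t = z * char_mono \<alpha> m t + g t) \<Longrightarrow> poscomb T \<alpha> d f"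

lemma poscomb_cong:
  assumes "poscomb T \<alpha> d g" "\<And>t. t \<in> T \<Longrightarrow> f t = g t"
  shows "poscomb T \<alpha> d f"
  using assms by cases (auto intro: poscomb.intros)

lemma poscomb_mono:
  "d \<le> sum m UNIV \<Longrightarrow> (\<And>t. t \<in> T \<Longrightarrow> f t = z * char_mono \<alpha> m t) \<Longrightarrow> poscomb T \<alpha> d f"
  by (rule poscomb.step[OF poscomb.zero, of _ "\<lambda>t. 0"]) auto

lemma poscomb_const: "poscomb T \<alpha> 0 (\<lambda>t. z)"
  by (rule poscomb_mono[of _ "\<lambda>i. 0" _ _ z]) auto

lemma poscomb_antimono: "poscomb T \<alpha> d g \<Longrightarrow> e \<le> d \<Longrightarrow> poscomb T \<alpha> e g"
proof (induct rule: poscomb.induct)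
  case (step g m f z)
  show ?case
    by (rule poscomb.step[OF step(2)[OF step(5)], of m _ z]) (use step(3-5) in auto)
qed (auto intro: poscomb.zero)

lemma poscomb_add:
  "poscomb T \<alpha> d f \<Longrightarrow> poscomb T \<alpha> d g \<Longrightarrow> poscomb T \<alpha> d (\<lambda>t. f t + g t)"
proof (induct rule: poscomb.induct)
  case (zero f)
  then show ?case by (auto intro: poscomb_cong)
next
  case (step f m f' z)
  show ?case
    by (rule poscomb.step[OF step(2)[OF step(5)] step(3), of _ z]) (simp add: step(4))
qed

lemma poscomb_sum:
  "(\<And>x. x \<in> S \<Longrightarrow> poscomb T \<alpha> d (f x)) \<Longrightarrow> poscomb T \<alpha> d (\<lambda>t. \<Sum>x\<in>S. f x t)"
  by (induct S rule: infinite_finite_induct) (auto intro: poscomb.zero poscomb_add)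

lemma poscomb_mult_mono:
  "poscomb T \<alpha> e g \<Longrightarrow> d \<le> sum m UNIV \<Longrightarrow> poscomb T \<alpha> (d + e) (\<lambda>t. z * char_mono \<alpha> m t * g t)"
proof (induct rule: poscomb.induct)
  case (zero f)
  then show ?case by (auto intro: poscomb.zero)
next
  case (step f m' f' z')
  show ?case
  proof (rule poscomb.step[OF step(2)[OF step(5)], of "\<lambda>i. m i + m' i" _ "z * z'"])
    show "d + e \<le> (\<Sum>i\<in>UNIV. m i + m' i)" using step(3,5) by (simp add: sum.distrib)
    show "z * char_mono \<alpha> m t * f' t =
      z * z' * char_mono \<alpha> (\<lambda>i. m i + m' i) t + z * char_mono \<alpha> m t * f t" if "t \<in> T" for t
      using step(4)[OF that] by (simp add: char_mono_add algebra_simps)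
  qed
qed

lemma poscomb_mult:
  "poscomb T \<alpha> d f \<Longrightarrow> poscomb T \<alpha> e g \<Longrightarrow> poscomb T \<alpha> (d + e) (\<lambda>t. f t * g t)"
proof (induct rule: poscomb.induct)
  case (zero f)
  then show ?case by (auto intro: poscomb.zero)
next
  case (step f m f' z)
  from poscomb_add[OF poscomb_mult_mono[OF step(5,3), of z] step(2)[OF step(5)]]
  show ?case
    by (rule poscomb_cong) (simp add: step(4) algebra_simps)
qed

lemma poscomb_cmult: "poscomb T \<alpha> d f \<Longrightarrow> poscomb T \<alpha> d (\<lambda>t. z * f t)"
  using poscomb_mult[OF poscomb_const] by fastforce

lemma poscomb_finite_sum:
  assumes "poscomb T \<alpha> d g"
  shows "\<exists>N z m. (\<forall>j<N. d \<le> sum (m j) UNIV) \<and> (\<forall>t\<in>T. g t = (\<Sum>j<N::nat. z j * char_mono \<alpha> (m j) t))"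
  using assms
proof induct
  case (zero g)
  then show ?case by (intro exI[of _ 0]) auto
next
  case (step g m f z)
  then obtain N z' m' where "\<forall>j<N. d \<le> sum (m' j) UNIV"
     "\<forall>t\<in>T. g t = (\<Sum>j<N::nat. z' j * char_mono \<alpha> (m' j) t)" by blast
  with step(3,4) show ?case
    by (intro exI[of _ "Suc N"] exI[of _ "z'(N := z)"] exI[of _ "m'(N := m)"]) (auto simp: less_Suc_eq)
qed

text \<open>Linear independence of characters, for one character against a family whose members may
  coincide. Evaluating the relation at the product of \<open>t0\<close> and \<open>t\<close> and
  subtracting \<open>\<xi> N t0\<close> times the relation at \<open>t\<close> removes the last
  term.\<close>

lemma Dedekind_independence:
  fixes \<xi> :: "nat \<Rightarrow> 'a \<Rightarrow> complex" and mul :: "'a \<Rightarrow> 'a \<Rightarrow> 'a"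
  assumes "\<And>s t. s \<in> T \<Longrightarrow> t \<in> T \<Longrightarrow> mul s t \<in> T"
    and "\<And>s t. s \<in> T \<Longrightarrow> t \<in> T \<Longrightarrow> \<psi> (mul s t) = \<psi> s * \<psi> t"
    and "\<exists>t\<in>T. \<psi> t \<noteq> 0"
    and "\<And>j s t. j < N \<Longrightarrow> s \<in> T \<Longrightarrow> t \<in> T \<Longrightarrow> \<xi> j (mul s t) = \<xi> j s * \<xi> j t"
    and "\<And>j. j < N \<Longrightarrow> \<exists>t\<in>T. \<xi> j t \<noteq> \<psi> t"
    and "\<And>t. t \<in> T \<Longrightarrow> c * \<psi> t = (\<Sum>j<N. z j * \<xi> j t)"
  shows "c = 0"
  using assms(4-6)
proof (induct N arbitrary: c z)
  case 0
  then show ?case using assms(3) by auto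
next
  case (Suc N)
  obtain t0 where t0: "t0 \<in> T" "\<xi> N t0 \<noteq> \<psi> t0" using Suc.prems(2)[of N] by auto
  have "c * (\<psi> t0 - \<xi> N t0) = 0"
  proof (rule Suc.hyps)
    fix t assume t: "t \<in> T"
    have "c * \<psi> t0 * \<psi> t = (\<Sum>j<Suc N. z j * \<xi> j t0 * \<xi> j t)"
      using Suc.prems(3)[OF assms(1)[OF t0(1) t]] Suc.prems(1) t t0(1)
      by (simp add: assms(2) mult.assoc)
    moreover have "c * \<xi> N t0 * \<psi> t = (\<Sum>j<Suc N. z j * \<xi> N t0 * \<xi> j t)"
    proof -
      have "c * \<xi> N t0 * \<psi> t = \<xi> N t0 * (c * \<psi> t)" by simp
      then show ?thesis by (simp only: Suc.prems(3)[OF t] sum_distrib_left mult_ac)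
    qed
    ultimately show "c * (\<psi> t0 - \<xi> N t0) * \<psi> t = (\<Sum>j<N. z j * (\<xi> j t0 - \<xi> N t0) * \<xi> j t)"
      by (simp add: algebra_simps sum_subtractf)
  qed (use Suc.prems in auto)
  then show ?case using t0(2) by simp
qed

section \<open>Translation and conjugation\<close>

lemma regular_translate:
  fixes g h :: "complex^'n^'n"
  shows "regular f \<Longrightarrow> regular (\<lambda>x. f (g ** x ** h))"
proof (induct rule: regular.induct)
  case (entry i j)
  show ?case
    unfolding mmult_nth by (intro regular_sum regular.intros)
next
  case inv_det
  have "(\<lambda>x. inverse (det (g ** x ** h))) = (\<lambda>x. inverse (det g) * inverse (det x) * inverse (det h))"
    by (simp add: det_mul fun_eq_iff)
  then show ?case by (simp only:) (intro regular.intros)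
qed (auto intro: regular.intros)

lemma det_conj:
  fixes A P :: "complex^'n^'n"
  assumes P: "invertible P"
  shows "det (P ** A ** matrix_inv P) = det A"
proof -
  have "det P * det (matrix_inv P) = 1"
    by (metis matrix_inv_mult(1)[OF P] det_I det_mul)
  then show ?thesis by (simp add: det_mul)
qed

lemma conj_mult:
  fixes A B P :: "complex^'n^'n"
  assumes "invertible P"
  shows "P ** (A ** B) ** matrix_inv P = (P ** A ** matrix_inv P) ** (P ** B ** matrix_inv P)"
proof -
  have "(P ** A ** matrix_inv P) ** (P ** B ** matrix_inv P) = P ** A ** (matrix_inv P ** P) ** B ** matrix_inv P"
    by (simp only: matrix_mul_assoc)
  then show ?thesis by (simp add: matrix_inv_mult[OF assms] matrix_mul_assoc)
qed

lemma conj_cancel: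
  fixes A P :: "complex^'n^'n"
  assumes "invertible P"
  shows "matrix_inv P ** (P ** A ** matrix_inv P) ** P = A"
proof -
  have "matrix_inv P ** (P ** A ** matrix_inv P) ** P = (matrix_inv P ** P) ** A ** (matrix_inv P ** P)"
    by (simp only: matrix_mul_assoc)
  then show ?thesis by (simp add: matrix_inv_mult[OF assms])
qed

lemma mpow_conj:
  fixes A P :: "complex^'n^'n"
  assumes "invertible P"
  shows "P ** mpow A k ** matrix_inv P = mpow (P ** A ** matrix_inv P) k"
  by (induct k) (simp_all add: matrix_inv_mult[OF assms] conj_mult[OF assms])

lemma mexp_conj:
  fixes A P :: "complex^'n^'n"
  shows "invertible P \<Longrightarrow> P ** mexp K A ** matrix_inv P = mexp K (P ** A ** matrix_inv P)"
  by (simp add: mexp_def mmult_sum_right mmult_sum_left mpow_conj)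

text \<open>The family \<open>\<alpha>\<close> stands for the simple roots if \<open>V\<close> is the unipotent radical of the Borel
  subgroup, and for their inverses if \<open>V\<close> is that of the opposite one.\<close>

locale root_cone =
  fixes T V :: "(complex^'n^'n) set"
    and \<alpha> :: "'r::finite \<Rightarrow> complex^'n^'n \<Rightarrow> complex"
    and P :: "complex^'n^'n"
  assumes T: "alg_group T" and V: "alg_group V"
    and unip: "\<And>u. u \<in> V \<Longrightarrow> unipotent u"
    and P: "invertible P"
    and diag: "\<And>t. t \<in> T \<Longrightarrow> diagonal (P ** t ** matrix_inv P)"
    and TV: "\<And>t v. t \<in> T \<Longrightarrow> v \<in> V \<Longrightarrow> t ** v ** matrix_inv t \<in> V"
    and char: "\<And>i. alg_character T (\<alpha> i)"
    and indep: "\<And>m m'. (\<And>t. t \<in> T \<Longrightarrow> char_mono \<alpha> m t = char_mono \<alpha> m' t) \<Longrightarrow> m = m'"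
    and cone: "\<And>\<beta> x. alg_character T \<beta> \<Longrightarrow> polycurve x \<Longrightarrow> range x \<subseteq> V \<Longrightarrow>
      (\<And>a b. x (a + b) = x a ** x b) \<Longrightarrow> \<exists>a. x a \<noteq> mat 1 \<Longrightarrow>
      (\<And>t a. t \<in> T \<Longrightarrow> t ** x a ** matrix_inv t = x (\<beta> t * a)) \<Longrightarrow>
      \<exists>m. m \<noteq> (\<lambda>i. 0) \<and> (\<forall>t\<in>T. \<beta> t = char_mono \<alpha> m t)"
begin

section \<open>Weights of the torus on matrix entries and on tangent vectors\<close>

definition cP :: "complex^'n^'n \<Rightarrow> complex^'n^'n" where
  "cP A = P ** A ** matrix_inv P"

text \<open>The character by which conjugation by \<open>T\<close> acts on the entry
  \<open>(p, q)\<close> in the coordinates where \<open>T\<close> is diagonal.\<close>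

definition wt :: "'n \<Rightarrow> 'n \<Rightarrow> complex^'n^'n \<Rightarrow> complex" where
  "wt p q t = cP t $ p $ p * cP (matrix_inv t) $ q $ q"

lemma Tinv: "t \<in> T \<Longrightarrow> t ** matrix_inv t = mat 1" "t \<in> T \<Longrightarrow> matrix_inv t ** t = mat 1"
  by (simp_all add: matrix_inv_mult alg_groupD(3)[OF T])

lemma cP_mult: "cP (A ** B) = cP A ** cP B"
  unfolding cP_def by (rule conj_mult[OF P])

lemma cP_one [simp]: "cP (mat 1) = mat 1"
  by (simp add: cP_def matrix_inv_mult[OF P])

lemma cP_inverse: "matrix_inv P ** cP A ** P = A"
  unfolding cP_def by (rule conj_cancel[OF P])

lemma cP_inj: "cP A = cP B \<Longrightarrow> A = B"
  by (metis cP_inverse)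

lemma cP_linear: "cP (A - B) = cP A - cP B" "cP (smul c A) = smul c (cP A)"
  by (simp_all add: cP_def mmult_diff_distrib)

lemma cP_T_offdiag: "t \<in> T \<Longrightarrow> p \<noteq> q \<Longrightarrow> cP t $ p $ q = 0"
  using diag by (simp add: diagonal_def cP_def)

lemma cP_T_left: "t \<in> T \<Longrightarrow> (cP t ** A) $ p $ q = cP t $ p $ p * A $ p $ q"
  unfolding mmult_nth by (subst sum.remove[of _ p]) (auto simp: cP_T_offdiag intro!: sum.neutral)

lemma cP_T_right: "t \<in> T \<Longrightarrow> (A ** cP t) $ p $ q = A $ p $ q * cP t $ q $ q"
  unfolding mmult_nth by (subst sum.remove[of _ q]) (auto simp: cP_T_offdiag intro!: sum.neutral)

lemma cP_conj: "t \<in> T \<Longrightarrow> cP (t ** A ** matrix_inv t) $ p $ q = wt p q t * cP A $ p $ q"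
  by (simp add: cP_mult cP_T_left cP_T_right wt_def alg_groupD(4)[OF T])

lemma cP_diag_inverse: "t \<in> T \<Longrightarrow> cP t $ p $ p * cP (matrix_inv t) $ p $ p = 1"
  using cP_T_left[of t "cP (matrix_inv t)" p p] by (simp add: cP_mult[symmetric] Tinv mat1_nth)

lemma cP_diag_mult: "s \<in> T \<Longrightarrow> t \<in> T \<Longrightarrow> cP (s ** t) $ p $ p = cP s $ p $ p * cP t $ p $ p"
  by (simp add: cP_mult cP_T_left)

lemma wt_mult:
  assumes "s \<in> T" "t \<in> T"
  shows "wt p q (s ** t) = wt p q s * wt p q t"
proof -
  have "(s ** t) ** (matrix_inv t ** matrix_inv s) = s ** (t ** matrix_inv t) ** matrix_inv s"
    by (simp only: matrix_mul_assoc)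
  then have "matrix_inv (s ** t) = matrix_inv t ** matrix_inv s"
    by (intro matrix_inv_eqI) (simp add: Tinv assms)
  then show ?thesis
    using assms by (simp add: wt_def cP_diag_mult alg_groupD(4)[OF T])
qed

lemma alg_character_wt: "alg_character T (wt p q)"
  unfolding alg_character_def
proof (intro conjI ballI)
  have reg: "regular (\<lambda>t. cP t $ p $ p)" for p
    unfolding cP_def by (rule regular_translate) (rule regular.entry)
  show "regular_on T (wt p q)"
    unfolding regular_on_def
  proof (intro exI conjI ballI)
    \<comment> \<open>The inverse of a diagonal entry is the product of the other ones divided by
      the determinant.\<close>
    let ?g = "\<lambda>t. cP t $ p $ p * ((\<Prod>r\<in>UNIV - {q}. cP t $ r $ r) * inverse (det t))"
    show "regular ?g" by (intro regular.mult reg regular_prod regular.inv_det)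
    fix t assume t: "t \<in> T"
    have "det t = det (cP t)" by (simp add: cP_def det_conj[OF P])
    also have "\<dots> = (\<Prod>r\<in>UNIV. cP t $ r $ r)" by (rule det_diagonal) (simp add: cP_T_offdiag t)
    also have "\<dots> = cP t $ q $ q * (\<Prod>r\<in>UNIV - {q}. cP t $ r $ r)" by (rule prod.remove) auto
    finally have det: "det t = cP t $ q $ q * (\<Prod>r\<in>UNIV - {q}. cP t $ r $ r)" .
    have "det t \<noteq> 0" using alg_groupD(3)[OF T t] by (simp add: invertible_det_nz)
    then have "cP (matrix_inv t) $ q $ q = cP t $ q $ q * cP (matrix_inv t) $ q $ q * ((\<Prod>r\<in>UNIV - {q}. cP t $ r $ r) * inverse (det t))"
      using det by (auto simp: field_simps)
    then show "wt p q t = ?g t"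
      unfolding cP_diag_inverse[OF t] wt_def by simp
  qed
  show "wt p q (s ** t) = wt p q s * wt p q t" if "s \<in> T" "t \<in> T" for s t
    by (rule wt_mult[OF that])
  show "wt p q t \<noteq> 0" if "t \<in> T" for t
    using cP_diag_inverse[OF that, of p] cP_diag_inverse[OF that, of q] by (auto simp: wt_def)
qed

text \<open>The projection to a weight space is a product of operators built from conjugation by
  elements of \<open>T\<close>, and these preserve tangent vectors.\<close>

lemma tangent_weight_component:
  assumes X: "tangent V X"
  obtains Y where "tangent V Y"
    "\<And>r s. cP Y $ r $ s = (if \<forall>t\<in>T. wt r s t = wt p q t then cP X $ r $ s else 0)"
proof -
  define B where "B = {(r, s). \<exists>t\<in>T. wt r s t \<noteq> wt p q t}"
  \<comment> \<open>\<open>c r s\<close> is the eigenvalue on the entry \<open>(r, s)\<close> of the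
    operators applied so far, and \<open>S\<close> is the set of entries already killed.\<close>
  define Q where "Q S Y c \<longleftrightarrow> tangent V Y \<and> (\<forall>r s. cP Y $ r $ s = c r s * cP X $ r $ s) \<and>
      (\<forall>r s. (r, s) \<notin> B \<longrightarrow> c r s = 1) \<and> (\<forall>r s. (r, s) \<in> S \<longrightarrow> c r s = 0)" for S Y c
  have "\<exists>Y c. Q S Y c" if "finite S" "S \<subseteq> B" for S
    using that
  proof (induct rule: finite_induct)
    case empty
    have "Q {} X (\<lambda>r s. 1)" using X by (simp add: Q_def)
    then show ?case by blast
  next
    case (insert b S)
    obtain r0 s0 where b: "b = (r0, s0)" by force
    then obtain t where t: "t \<in> T" "wt r0 s0 t \<noteq> wt p q t" using insert.prems by (auto simp: B_def)
    obtain Y c where "Q S Y c" using insert.hyps(3) insert.prems by blast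
    then have Y: "tangent V Y" "\<And>r s. cP Y $ r $ s = c r s * cP X $ r $ s"
      "\<And>r s. (r, s) \<notin> B \<Longrightarrow> c r s = 1" "\<And>r s. (r, s) \<in> S \<Longrightarrow> c r s = 0"
      unfolding Q_def by metis+
    \<comment> \<open>A Lagrange interpolation factor: it is 1 on the wanted weight and 0 on the
      weight of \<open>(r0, s0)\<close>.\<close>
    let ?k = "inverse (wt p q t - wt r0 s0 t)"
    let ?Y = "smul ?k (t ** Y ** matrix_inv t + smul (- wt r0 s0 t) Y)"
    let ?c = "\<lambda>r s. ?k * (wt r s t - wt r0 s0 t) * c r s"
    have "?Y = smul ?k (t ** Y ** matrix_inv t - smul (wt r0 s0 t) Y)"
      by (rule mat_eqI) simp
    then have cPY: "cP ?Y $ r $ s = ?c r s * cP X $ r $ s" for r s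
      by (simp add: cP_linear cP_conj[OF t(1)] Y(2) algebra_simps)
    have "tangent V ?Y"
      by (intro tangent_smul tangent_add V tangent_conj Y(1) TV t(1) alg_groupD(3)[OF T])
    moreover have "?c r s = 1" if "(r, s) \<notin> B" for r s
      using that t Y(3)[OF that] by (simp add: B_def)
    moreover have "?c r s = 0" if "(r, s) \<in> insert b S" for r s
      using that b Y(4)[of r s] by auto
    ultimately have "Q (insert b S) ?Y ?c" using cPY unfolding Q_def by simp
    then show ?case by blast
  qed
  from this[of B] obtain Y c where "Q B Y c" by auto
  then have Y: "tangent V Y" "\<And>r s. cP Y $ r $ s = c r s * cP X $ r $ s"
    "\<And>r s. (r, s) \<notin> B \<Longrightarrow> c r s = 1" "\<And>r s. (r, s) \<in> B \<Longrightarrow> c r s = 0"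
    unfolding Q_def by metis+
  show ?thesis
  proof (rule that[OF Y(1)])
    fix r s
    show "cP Y $ r $ s = (if \<forall>t\<in>T. wt r s t = wt p q t then cP X $ r $ s else 0)"
      using Y(3)[of r s] Y(4)[of r s] by (auto simp: Y(2) B_def)
  qed
qed

text \<open>The component of \<open>X\<close> of weight \<open>wt p q\<close> is tangent, nonzero
  and nilpotent. Its exponentials form a one-parameter group in \<open>V\<close> on which
  \<open>T\<close> acts through \<open>wt p q\<close>, so that \<open>cone\<close> applies.\<close>

lemma tangent_weight:
  assumes X: "tangent V X" and nz: "cP X $ p $ q \<noteq> 0"
  shows "\<exists>m. m \<noteq> (\<lambda>i. 0) \<and> (\<forall>t\<in>T. wt p q t = char_mono \<alpha> m t)"
proof -
  obtain Y where Y: "tangent V Y"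
    "\<And>r s. cP Y $ r $ s = (if \<forall>t\<in>T. wt r s t = wt p q t then cP X $ r $ s else 0)"
    using tangent_weight_component[OF X, of p q] by blast
  have conj: "t ** Y ** matrix_inv t = smul (wt p q t) Y" if "t \<in> T" for t
    by (rule cP_inj, rule mat_eqI) (use that in \<open>auto simp: cP_conj cP_linear Y(2)\<close>)
  obtain k where k: "mpow Y k = 0" using tangent_nilpotent[OF unip Y(1)] by blast
  define K where "K = Suc (Suc k)"
  have K: "mpow Y K = 0" "K > 1" using k by (simp_all add: K_def)
  show ?thesis
  proof (rule cone[where x = "\<lambda>a. mexp K (smul a Y)", OF alg_character_wt])
    show "range (\<lambda>a. mexp K (smul a Y)) \<subseteq> V" using tangent_mexp[OF V unip Y(1) K] by auto
    show "mexp K (smul (a + b) Y) = mexp K (smul a Y) ** mexp K (smul b Y)" for a b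
      by (rule mexp_add[OF K(1)])
    show "t ** mexp K (smul a Y) ** matrix_inv t = mexp K (smul (wt p q t * a) Y)" if "t \<in> T" for t a
      by (simp add: mexp_conj alg_groupD(3)[OF T that] conj[OF that] mult.commute)
    \<comment> \<open>A constant exponential curve would have velocity \<open>Y = 0\<close>,
      although the entry \<open>(p, q)\<close> of \<open>cP Y\<close> is nonzero.\<close>
    show "\<exists>a. mexp K (smul a Y) \<noteq> mat 1"
    proof (rule ccontr)
      assume *: "\<nexists>a. mexp K (smul a Y) \<noteq> mat 1"
      obtain D where D: "polycurve D" "D 0 = Y" "\<And>s. mexp K (smul s Y) = mat 1 + smul s (D s)"
        using mexp_expansion[OF K(2)] by metis
      have "smul s (D s) = 0" for s using D(3)[of s] * by simp
      then have D0: "s * D s $ i $ j = 0" for s i j by (metis smul_nth zero_index)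
      have "D 0 $ i $ j = 0" for i j
      proof (rule polyf_eq_nonzero[where f = "\<lambda>s. D s $ i $ j" and g = "\<lambda>s. 0"])
        show "polyf (\<lambda>s. D s $ i $ j)" using D(1) by (simp add: polycurve_def)
        show "D s $ i $ j = 0" if "s \<noteq> 0" for s using D0[of s i j] that by simp
      qed simp
      then have "Y = 0" unfolding D(2) by (intro mat_eqI) simp
      then have "cP Y = 0" by (simp add: cP_def)
      then show False using Y(2)[of p q] nz by simp
    qed
  qed (rule polycurve_mexp)
qed

section \<open>Expansion of regular functions along conjugation by the torus\<close>

lemma sum_pos_of_nonzero:
  fixes m :: "'r \<Rightarrow> nat"
  shows "m \<noteq> (\<lambda>i. 0) \<Longrightarrow> 1 \<le> sum m UNIV"
  by (rule ccontr) (auto simp: not_le)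

text \<open>In diagonal coordinates each nonzero entry is multiplied by a weight, which by
  \<open>tangent_weight\<close> is a monomial of positive degree; returning to the original
  coordinates is linear.\<close>

lemma poscomb_tangent:
  assumes X: "tangent V X"
  shows "poscomb T \<alpha> 1 (\<lambda>t. (t ** X ** matrix_inv t) $ i $ j)"
proof -
  have "poscomb T \<alpha> 1 (\<lambda>t. wt p q t * cP X $ p $ q)" for p q
  proof (cases "cP X $ p $ q = 0")
    case True
    then show ?thesis by (auto intro: poscomb.zero)
  next
    case False
    then obtain m where m: "m \<noteq> (\<lambda>i. 0)" "\<forall>t\<in>T. wt p q t = char_mono \<alpha> m t"
      using tangent_weight[OF X] by blast
    show ?thesis
      by (rule poscomb_mono[OF sum_pos_of_nonzero[OF m(1)], of _ _ "cP X $ p $ q"]) (simp add: m(2))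
  qed
  then have "poscomb T \<alpha> 1 (\<lambda>t. \<Sum>q\<in>UNIV. \<Sum>p\<in>UNIV. (matrix_inv P $ i $ p * P $ q $ j) * (wt p q t * cP X $ p $ q))"
    by (intro poscomb_sum poscomb_cmult)
  then show ?thesis
  proof (rule poscomb_cong)
    fix t assume t: "t \<in> T"
    have "(t ** X ** matrix_inv t) $ i $ j = (matrix_inv P ** cP (t ** X ** matrix_inv t) ** P) $ i $ j"
      by (simp only: cP_inverse)
    then show "(t ** X ** matrix_inv t) $ i $ j =
      (\<Sum>q\<in>UNIV. \<Sum>p\<in>UNIV. (matrix_inv P $ i $ p * P $ q $ j) * (wt p q t * cP X $ p $ q))"
      by (simp add: mmult_nth[of _ P] mmult_nth[of "matrix_inv P"] cP_conj[OF t] sum_distrib_right sum_distrib_left mult_ac)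
  qed
qed

lemma poscomb_mexp:
  fixes Z :: "complex^'n^'n \<Rightarrow> complex^'n^'n"
  assumes Z: "\<And>i j. poscomb T \<alpha> 1 (\<lambda>t. Z t $ i $ j)"
  shows "poscomb T \<alpha> 1 (\<lambda>t. (mexp (Suc K) (Z t) - mat 1) $ i $ j)"
proof -
  have pw: "poscomb T \<alpha> 1 (\<lambda>t. mpow (Z t) (Suc k) $ i $ j)" for k i j
  proof (induct k arbitrary: i j)
    case 0
    then show ?case using Z by simp
  next
    case (Suc k)
    \<comment> \<open>One factor of positive degree is enough; the power is counted with degree
      0.\<close>
    have "poscomb T \<alpha> (0 + 1) (\<lambda>t. \<Sum>l\<in>UNIV. mpow (Z t) (Suc k) $ i $ l * Z t $ l $ j)"
      by (intro poscomb_sum poscomb_mult Z poscomb_antimono[OF Suc]) simp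
    then show ?case unfolding mpow.simps(2)[of _ "Suc k"] mmult_nth[of _ "Z _"] by simp
  qed
  have "(mexp (Suc K) A - mat 1) $ i $ j = (\<Sum>k<K. inverse (fact (Suc k)) * mpow A (Suc k) $ i $ j)" for A :: "complex^'n^'n"
    unfolding mexp_def sum.lessThan_Suc_shift by (simp del: fact_Suc)
  then show ?thesis by (simp only:) (intro poscomb_sum poscomb_cmult pw)
qed

text \<open>Conjugation commutes with \<open>mexp\<close>, so the logarithm of \<open>u\<close>
  reduces this to tangent vectors.\<close>

lemma poscomb_conj_entry:
  assumes "u \<in> V"
  shows "poscomb T \<alpha> 1 (\<lambda>t. (t ** u ** matrix_inv t - mat 1) $ i $ j)"
proof -
  obtain X K where X: "K > 1" "mpow X K = 0" "tangent V X" "u = mexp K X"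
    using unipotent_group_log[OF V unip assms] by metis
  obtain L where L: "K = Suc L" using X(1) by (cases K) auto
  from poscomb_mexp[OF poscomb_tangent[OF X(3)], of L i j] show ?thesis
    by (rule poscomb_cong) (simp add: X(4) L mexp_conj alg_groupD(3)[OF T])
qed

lemma det_one: "u \<in> V \<Longrightarrow> t \<in> T \<Longrightarrow> det (t ** u ** matrix_inv t) = 1"
proof -
  assume u: "u \<in> V" and t: "t \<in> T"
  obtain k where "mpow (u - mat 1) k = 0" using unip[OF u] by (auto simp: unipotent_iff)
  from det_nilpotent_line[OF this, of 1] show ?thesis
    by (simp add: det_conj alg_groupD(3)[OF T t])
qed

text \<open>This holds for matrix entries, and passes to products by expanding both factors around
  the identity.\<close>

lemma poscomb_regular:
  assumes "regular f" "u \<in> V"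
  shows "poscomb T \<alpha> 1 (\<lambda>t. f (t ** u ** matrix_inv t) - f (mat 1))"
  using assms(1)
proof induct
  case (entry i j)
  then show ?case using poscomb_conj_entry[OF assms(2), of i j] by simp
next
  case (mult f g)
  let ?u = "\<lambda>t. t ** u ** matrix_inv t"
  have "poscomb T \<alpha> (0 + 1) (\<lambda>t. g (mat 1) * (f (?u t) - f (mat 1)))"
    "poscomb T \<alpha> (0 + 1) (\<lambda>t. f (mat 1) * (g (?u t) - g (mat 1)))"
    "poscomb T \<alpha> (1 + 1) (\<lambda>t. (f (?u t) - f (mat 1)) * (g (?u t) - g (mat 1)))"
    by (intro poscomb_mult poscomb_const mult)+
  from poscomb_add[OF poscomb_add[OF this(1,2)] poscomb_antimono[OF this(3)]]
  have "poscomb T \<alpha> 1 (\<lambda>t. g (mat 1) * (f (?u t) - f (mat 1)) + f (mat 1) * (g (?u t) - g (mat 1))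
     + (f (?u t) - f (mat 1)) * (g (?u t) - g (mat 1)))" by simp
  then show ?case by (rule poscomb_cong) (simp add: algebra_simps)
next
  case (add f g)
  from poscomb_add[OF add(2,4)] show ?case by (rule poscomb_cong) simp
qed (auto intro!: poscomb.zero simp: det_one assms(2))

text \<open>For a matrix entry the defect of additivity is an entry of the product of
  \<open>?u t\<close> and \<open>?v t\<close>, both of order one; for products of functions the
  defect obeys a Leibniz rule up to products of first-order terms.\<close>

lemma poscomb_regular_mult:
  assumes "regular f" and u: "u \<in> V" and v: "v \<in> V"
  shows "poscomb T \<alpha> 2 (\<lambda>t. f (t ** (u ** v) ** matrix_inv t) - f (t ** u ** matrix_inv t)
    - f (t ** v ** matrix_inv t) + f (mat 1))"
  using assms(1)
proof induct
  case (entry i j)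
  let ?u = "\<lambda>t. t ** u ** matrix_inv t - mat 1"
  let ?v = "\<lambda>t. t ** v ** matrix_inv t - mat 1"
  have "poscomb T \<alpha> (1 + 1) (\<lambda>t. \<Sum>k\<in>UNIV. ?u t $ i $ k * ?v t $ k $ j)"
    by (intro poscomb_sum poscomb_mult poscomb_conj_entry u v)
  then have "poscomb T \<alpha> 2 (\<lambda>t. (?u t ** ?v t) $ i $ j)"
    by (simp only: mmult_nth[of "?u _"] one_add_one)
  then show ?case
  proof (rule poscomb_cong)
    fix t assume t: "t \<in> T"
    have "t ** u ** matrix_inv t ** (t ** v ** matrix_inv t) = t ** u ** (matrix_inv t ** t) ** v ** matrix_inv t"
      by (simp only: matrix_mul_assoc)
    then have "?u t ** ?v t = t ** (u ** v) ** matrix_inv t - t ** u ** matrix_inv t - t ** v ** matrix_inv t + mat 1"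
      by (simp add: mmult_diff_distrib Tinv[OF t] matrix_mul_assoc algebra_simps)
    then show "(t ** (u ** v) ** matrix_inv t) $ i $ j - (t ** u ** matrix_inv t) $ i $ j
       - (t ** v ** matrix_inv t) $ i $ j + mat 1 $ i $ j = (?u t ** ?v t) $ i $ j"
      by simp
  qed
next
  case (mult f g)
  let ?u = "\<lambda>t. t ** u ** matrix_inv t" and ?v = "\<lambda>t. t ** v ** matrix_inv t"
    and ?w = "\<lambda>t. t ** (u ** v) ** matrix_inv t"
  let ?D = "\<lambda>f t. f (?w t) - f (?u t) - f (?v t) + f (mat 1)"
  have uv: "u ** v \<in> V" using V u v by (rule alg_groupD)
  have g0: "poscomb T \<alpha> 0 (\<lambda>t. g (?w t))"
  proof (rule poscomb_cong)
    show "poscomb T \<alpha> 0 (\<lambda>t. g (mat 1) + (g (?w t) - g (mat 1)))"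
      by (intro poscomb_add poscomb_const poscomb_antimono[OF poscomb_regular[OF mult(3) uv]]) simp
  qed simp
  have f0: "poscomb T \<alpha> 0 (\<lambda>t. f (mat 1) + (f (?u t) - f (mat 1)) + (f (?v t) - f (mat 1)))"
    by (intro poscomb_add poscomb_const)
       (rule poscomb_antimono[OF poscomb_regular[OF mult(1)]], use u v in simp_all)+
  have 1: "poscomb T \<alpha> (2 + 0) (\<lambda>t. ?D f t * g (?w t))"
    by (rule poscomb_mult[OF mult(2) g0])
  have 2: "poscomb T \<alpha> (0 + 2) (\<lambda>t. (f (mat 1) + (f (?u t) - f (mat 1)) + (f (?v t) - f (mat 1))) * ?D g t)"
    by (rule poscomb_mult[OF f0 mult(4)])
  have 3: "poscomb T \<alpha> (1 + 1) (\<lambda>t. (f (?u t) - f (mat 1)) * (g (?v t) - g (mat 1)))"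
    by (intro poscomb_mult poscomb_regular mult u v)
  have 4: "poscomb T \<alpha> (1 + 1) (\<lambda>t. (f (?v t) - f (mat 1)) * (g (?u t) - g (mat 1)))"
    by (intro poscomb_mult poscomb_regular mult u v)
  \<comment> \<open>The defect of the product of \<open>f\<close> and \<open>g\<close>, written
    through the defects of \<open>f\<close> and \<open>g\<close> and two products of first-order
    terms.\<close>
  have "poscomb T \<alpha> 2 (\<lambda>t. ?D f t * g (?w t)
      + (f (mat 1) + (f (?u t) - f (mat 1)) + (f (?v t) - f (mat 1))) * ?D g t
      + ((f (?u t) - f (mat 1)) * (g (?v t) - g (mat 1))
      + (f (?v t) - f (mat 1)) * (g (?u t) - g (mat 1))))"
    using 1 2 3 4 unfolding add_0_left add_0_right one_add_one by (intro poscomb_add)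
  then show ?case by (rule poscomb_cong) (simp add: algebra_simps)
next
  case (add f g)
  from poscomb_add[OF add(2,4)] show ?case by (rule poscomb_cong) simp
qed (auto intro!: poscomb.zero simp: det_one u v alg_groupD(2)[OF V])

section \<open>Regular functions of small weight on the unipotent group\<close>

lemma char_mono_mult: "s \<in> T \<Longrightarrow> t \<in> T \<Longrightarrow> char_mono \<alpha> m (s ** t) = char_mono \<alpha> m s * char_mono \<alpha> m t"
  using char by (simp add: char_mono_def alg_character_def power_mult_distrib prod.distrib)

text \<open>By \<open>indep\<close> a monomial of degree below \<open>d\<close> is a character
  different from all monomials of degree at least \<open>d\<close>, so independence of characters
  applies.\<close>

lemma poscomb_independence:
  assumes "poscomb T \<alpha> d g" "sum m UNIV < d" "\<And>t. t \<in> T \<Longrightarrow> c * char_mono \<alpha> m t = g t"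
  shows "c = 0"
proof -
  obtain N z m' where N: "\<And>j. j < N \<Longrightarrow> d \<le> sum (m' j) UNIV"
     "\<And>t. t \<in> T \<Longrightarrow> g t = (\<Sum>j<N::nat. z j * char_mono \<alpha> (m' j) t)"
    using poscomb_finite_sum[OF assms(1)] by blast
  show ?thesis
  proof (rule Dedekind_independence[of T "(**)" "char_mono \<alpha> m" N "\<lambda>j. char_mono \<alpha> (m' j)" c z])
    show "\<exists>t\<in>T. char_mono \<alpha> (m' j) t \<noteq> char_mono \<alpha> m t" if "j < N" for j
      using indep[of "m' j" m] N(1)[OF that] assms(2) by fastforce
    show "\<exists>t\<in>T. char_mono \<alpha> m t \<noteq> 0"
      using alg_groupD(1)[OF T] char by (intro bexI[of _ "mat 1"]) (auto simp: char_mono_def alg_character_def)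
  qed (use N(2) assms(3) char_mono_mult alg_groupD(2)[OF T] in auto)
qed

text \<open>The constant \<open>f u - f (mat 1)\<close> is a multiple of the monomial of degree 0,
  but lies in the span of those of positive degree.\<close>

lemma invariant_imp_const:
  assumes "regular_on V f" "u \<in> V" "\<And>t. t \<in> T \<Longrightarrow> f (t ** u ** matrix_inv t) = f u"
  shows "f u = f (mat 1)"
proof -
  obtain g where g: "regular g" "\<And>x. x \<in> V \<Longrightarrow> f x = g x"
    using assms(1) unfolding regular_on_def by blast
  have "f u - f (mat 1) = 0"
  proof (rule poscomb_independence[OF poscomb_regular[OF g(1) assms(2)], of "\<lambda>i. 0"])
    show "(f u - f (mat 1)) * char_mono \<alpha> (\<lambda>i. 0) t = g (t ** u ** matrix_inv t) - g (mat 1)" if "t \<in> T" for t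
      using assms(3)[OF that] g(2)[OF TV[OF that assms(2)]] g(2)[OF alg_groupD(1)[OF V]] by simp
  qed simp
  then show ?thesis by simp
qed

text \<open>The defect of additivity of \<open>f\<close>, as a function of \<open>t\<close>, is a multiple of \<open>\<alpha> i\<close>, a monomial of
  degree 1; but it also lies in the span of the monomials of degree at least 2.\<close>

lemma simple_weight_imp_additive:
  assumes "regular_on V f" "u \<in> V" "v \<in> V"
    and wt: "\<And>t x. t \<in> T \<Longrightarrow> x \<in> V \<Longrightarrow> f (t ** x ** matrix_inv t) = \<alpha> i t * f x"
  shows "f (mat 1) = 0" "f (u ** v) = f u + f v"
proof -
  obtain g where g: "regular g" "\<And>x. x \<in> V \<Longrightarrow> f x = g x"
    using assms(1) unfolding regular_on_def by blast
  let ?e = "\<lambda>j. if j = i then 1 else 0 :: nat"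
  have uv: "u ** v \<in> V" by (rule alg_groupD(2)[OF V assms(2,3)])
  have one: "mat 1 \<in> V" by (rule alg_groupD(1)[OF V])
  \<comment> \<open>Some \<open>t\<close> has \<open>\<alpha> i t \<noteq> 1\<close>; conjugating
    \<open>mat 1\<close> by it forces \<open>f (mat 1) = 0\<close>.\<close>
  have "?e \<noteq> (\<lambda>j. 0)" by (auto simp: fun_eq_iff)
  then obtain t where t: "t \<in> T" "char_mono \<alpha> ?e t \<noteq> char_mono \<alpha> (\<lambda>j. 0) t"
    using indep by blast
  show f1: "f (mat 1) = 0"
    using wt[OF t(1) one] t(2) by (auto simp: char_mono_single Tinv[OF t(1)])
  have "f (u ** v) - f u - f v = 0"
  proof (rule poscomb_independence[OF poscomb_regular_mult[OF g(1) assms(2,3)], of ?e])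
    fix t assume t: "t \<in> T"
    show "(f (u ** v) - f u - f v) * char_mono \<alpha> ?e t =
       g (t ** (u ** v) ** matrix_inv t) - g (t ** u ** matrix_inv t) - g (t ** v ** matrix_inv t) + g (mat 1)"
      using f1 wt[OF t uv] wt[OF t assms(2)] wt[OF t assms(3)] uv assms one
      by (simp add: g(2)[symmetric] TV t char_mono_single algebra_simps)
  qed simp
  then show "f (u ** v) = f u + f v" by (simp add: algebra_simps)
qed

end

section \<open>The group, its minors, and the rank one subgroups\<close>

lemma diagonal_commute:
  assumes "diagonal A" "diagonal B"
  shows "A ** B = B ** A"
proof (rule mat_eqI)
  fix p q
  have "A $ p $ k * B $ k $ q = B $ p $ k * A $ k $ q" for k
    using assms by (cases "p = k"; cases "k = q") (simp_all add: diagonal_def)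
  then show "(A ** B) $ p $ q = (B ** A) $ p $ q" by (simp add: mmult_nth)
qed

lemma diagonalized_commute:
  fixes P :: "complex^'n^'n"
  assumes "invertible P" "diagonal (P ** s ** matrix_inv P)" "diagonal (P ** t ** matrix_inv P)"
  shows "s ** t = t ** s"
  using diagonal_commute[OF assms(2,3)] conj_cancel[OF assms(1)] by (metis conj_mult[OF assms(1)])

lemma polycurve_iff: "polycurve x \<longleftrightarrow> (\<forall>i j. \<exists>p. \<forall>a. x a $ i $ j = poly p a)"
  by (simp add: polycurve_def polyf_def)

lemma mat2_nth [simp]:
  "mat2 a b c d $ 1 $ 1 = a" "mat2 a b c d $ 1 $ 2 = b"
  "mat2 a b c d $ 2 $ 1 = c" "mat2 a b c d $ 2 $ 2 = d"
  by (simp_all add: mat2_def vector_2)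

lemma mat2_mult:
  "mat2 a b c d ** mat2 a' b' c' d' = mat2 (a*a' + b*c') (a*b' + b*d') (c*a' + d*c') (c*b' + d*d')"
  by (simp add: vec_eq_iff forall_2 mmult_nth sum_2)

lemma mat2_SL2: "mat2 a b c d \<in> SL2 \<longleftrightarrow> a * d - b * c = 1"
  by (simp add: SL2_def det_2)

lemma regular_on_subset: "regular_on G f \<Longrightarrow> H \<subseteq> G \<Longrightarrow> regular_on H f"
  unfolding regular_on_def by blast

lemma regular_on_add: "regular_on G f \<Longrightarrow> regular_on G g \<Longrightarrow> regular_on G (\<lambda>x. f x + g x)"
  unfolding regular_on_def by (metis regular.add)

lemma regular_on_mult: "regular_on G f \<Longrightarrow> regular_on G g \<Longrightarrow> regular_on G (\<lambda>x. f x * g x)"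
  unfolding regular_on_def by (metis regular.mult)

lemma regular_on_const: "regular_on G (\<lambda>x. z)"
  unfolding regular_on_def by (metis regular.const)

lemma regular_on_cmult: "regular_on G f \<Longrightarrow> regular_on G (\<lambda>x. z * f x)"
  by (intro regular_on_mult regular_on_const)

lemma regular_on_diff: "regular_on G f \<Longrightarrow> regular_on G g \<Longrightarrow> regular_on G (\<lambda>x. f x - g x)"
  using regular_on_add[OF _ regular_on_cmult[of G g "-1"]] by simp

lemma regular_on_prod:
  "(\<And>j. j \<in> S \<Longrightarrow> regular_on G (f j)) \<Longrightarrow> regular_on G (\<lambda>x. \<Prod>j\<in>S. f j x)"
  by (induct S rule: infinite_finite_induct) (auto intro: regular_on_const regular_on_mult)

lemma regular_on_translate:
  assumes "regular_on G f" "alg_group G" "g \<in> G" "h \<in> G"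
  shows "regular_on G (\<lambda>x. f (g ** x ** h))"
proof -
  obtain f' where f': "regular f'" "\<And>x. x \<in> G \<Longrightarrow> f x = f' x"
    using assms(1) unfolding regular_on_def by blast
  then show ?thesis
    unfolding regular_on_def using assms(2-4)
    by (intro exI[of _ "\<lambda>x. f' (g ** x ** h)"] conjI regular_translate) (auto simp: alg_groupD)
qed

lemma alg_characterD:
  assumes "alg_group T" "alg_character T \<xi>"
  shows "s \<in> T \<Longrightarrow> t \<in> T \<Longrightarrow> \<xi> (s ** t) = \<xi> s * \<xi> t" "t \<in> T \<Longrightarrow> \<xi> t \<noteq> 0"
    "\<xi> (mat 1) = 1" "t \<in> T \<Longrightarrow> \<xi> (matrix_inv t) = inverse (\<xi> t)"
proof -
  show m: "\<xi> (s ** t) = \<xi> s * \<xi> t" if "s \<in> T" "t \<in> T" for s t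
    using assms(2) that by (simp add: alg_character_def)
  show nz: "\<xi> t \<noteq> 0" if "t \<in> T" for t using assms(2) that by (simp add: alg_character_def)
  have one: "mat 1 \<in> T" by (rule alg_groupD[OF assms(1)])
  show 1: "\<xi> (mat 1) = 1" using m[OF one one] nz[OF one] by simp
  show "\<xi> (matrix_inv t) = inverse (\<xi> t)" if "t \<in> T"
  proof -
    have "\<xi> t * \<xi> (matrix_inv t) = 1"
      using m[OF that alg_groupD(4)[OF assms(1) that]] 1
        matrix_inv_mult(1)[OF alg_groupD(3)[OF assms(1) that]] by simp
    then show ?thesis by (metis inverse_unique)
  qed
qed

text \<open>\<open>P\<close> is a fixed change of basis that makes the torus diagonal; both
  instances of \<open>root_cone\<close> below use it.\<close>

locale minor_setting =
  fixes G T B Bm U Um :: "(complex^'n^'n) set"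
    and \<alpha> \<omega> \<Delta> :: "'r::finite \<Rightarrow> complex^'n^'n \<Rightarrow> complex"
    and \<phi> :: "'r \<Rightarrow> complex^2^2 \<Rightarrow> complex^'n^'n"
    and c :: "'r \<Rightarrow> 'r \<Rightarrow> int"
    and P :: "complex^'n^'n"
  assumes G: "alg_group G"
    and T: "alg_group T"
    and P: "invertible P"
    and diag: "\<And>t. t \<in> T \<Longrightarrow> diagonal (P ** t ** matrix_inv P)"
    and B: "alg_group B" "B \<subseteq> G"
    and Bm: "alg_group Bm" "Bm \<subseteq> G"
    and BBm: "B \<inter> Bm = T"
    and U: "alg_group U" "normal U (GLs B)" "\<And>u. u \<in> U \<Longrightarrow> unipotent u"
    and Um: "alg_group Um" "normal Um (GLs Bm)" "\<And>u. u \<in> Um \<Longrightarrow> unipotent u"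
    and simple: "simple_roots G T U Um \<alpha>"
    and attached: "\<And>i. attached G T (\<alpha> i) (\<phi> i)"
    and cartan: "cartan_matrix \<alpha> \<phi> c"
    and ADE: "type_ADE c"
    and simply_connected: "simply_connected_group T \<phi>"
    and weights: "fundamental_weights T \<phi> \<omega>"
    and minor: "\<And>i. principal_minor G T U Um (\<omega> i) (\<Delta> i)"
begin

section \<open>The torus, the simple roots and positivity\<close>

lemma radical_subset: "U \<subseteq> B" "Um \<subseteq> Bm"
  using normal.axioms(1)[OF U(2)] normal.axioms(1)[OF Um(2)] subgroup.subset by fastforce+

lemma in_G: "t \<in> T \<Longrightarrow> t \<in> G" "u \<in> U \<Longrightarrow> u \<in> G" "n \<in> Um \<Longrightarrow> n \<in> G"
  using radical_subset B(2) Bm(2) BBm by auto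

lemma U_inter_Um: "x \<in> U \<Longrightarrow> x \<in> Um \<Longrightarrow> x \<in> T"
  using radical_subset BBm by auto

lemma T_normalizes:
  "t \<in> T \<Longrightarrow> u \<in> U \<Longrightarrow> t ** u ** matrix_inv t \<in> U"
  "t \<in> T \<Longrightarrow> n \<in> Um \<Longrightarrow> t ** n ** matrix_inv t \<in> Um"
  using alg_group_normal_conj[OF B(1) U(2)] alg_group_normal_conj[OF Bm(1) Um(2)] BBm by auto

lemma Tinv: "t \<in> T \<Longrightarrow> t ** matrix_inv t = mat 1" "t \<in> T \<Longrightarrow> matrix_inv t ** t = mat 1"
  by (simp_all add: matrix_inv_mult alg_groupD(3)[OF T])

lemma T_cancel: "t \<in> T \<Longrightarrow> A ** t ** matrix_inv t = A" "t \<in> T \<Longrightarrow> A ** matrix_inv t ** t = A"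
  by (simp_all add: matrix_mul_assoc[symmetric] Tinv)

lemma T_commute: "s \<in> T \<Longrightarrow> t \<in> T \<Longrightarrow> s ** t = t ** s"
  by (rule diagonalized_commute[OF P diag diag])

lemma alpha_char: "alg_character T (\<alpha> i)"
  using simple by (auto simp: simple_roots_def is_root_def root_subgroup_def)

lemma alpha_inv_char: "alg_character T (\<lambda>t. inverse (\<alpha> i t))"
  using attached[of i] by (simp add: attached_def root_subgroup_def)

lemmas alphaD = alg_characterD[OF T alpha_char]

lemma char_comb_int:
  "t \<in> T \<Longrightarrow> char_comb \<alpha> (\<lambda>i. int (m i) - int (m' i)) t = char_mono \<alpha> m t / char_mono \<alpha> m' t"
  by (simp add: char_comb_def char_mono_def power_int_diff alphaD prod_dividef)

lemma char_mono_nonzero: "t \<in> T \<Longrightarrow> char_mono \<alpha> m t \<noteq> 0"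
  by (simp add: char_mono_def alphaD)

lemma char_comb_eq_1: "(\<And>t. t \<in> T \<Longrightarrow> char_comb \<alpha> m t = 1) \<Longrightarrow> m = (\<lambda>i. 0)"
  using simple unfolding simple_roots_def by blast

lemma char_mono_inj:
  assumes "\<And>t. t \<in> T \<Longrightarrow> char_mono \<alpha> m t = char_mono \<alpha> m' t"
  shows "m = m'"
proof -
  have "(\<lambda>i. int (m i) - int (m' i)) = (\<lambda>i. 0)"
    by (rule char_comb_eq_1) (simp add: char_comb_int assms char_mono_nonzero)
  then show ?thesis by (auto simp: fun_eq_iff)
qed

lemma char_mono_inverse: "char_mono (\<lambda>i t. inverse (\<alpha> i t)) m t = inverse (char_mono \<alpha> m t)"
  by (simp add: char_mono_def power_inverse prod_inversef[symmetric] o_def)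

text \<open>This excludes roots of the wrong sign: a root subgroup contained in both radicals would
  lie in \<open>T\<close> and commute with \<open>T\<close>, while \<open>T\<close> scales its
  parameter by a nontrivial character.\<close>

lemma root_subgroup_in_T_trivial:
  assumes x: "root_subgroup G T \<beta> x" "range x \<subseteq> T" and \<beta>: "m \<noteq> (\<lambda>i. 0)" "\<forall>t\<in>T. \<beta> t = char_comb \<alpha> m t"
  shows False
proof -
  have hom: "x (a + b) = x a ** x b" and act: "t \<in> T \<Longrightarrow> t ** x a ** matrix_inv t = x (\<beta> t * a)" for a b t
    using x(1) unfolding root_subgroup_def by blast+
  have xT: "x a \<in> T" for a using x(2) by auto
  have x0: "x 0 = mat 1"
    using hom[of 0 0] T_cancel(1)[OF xT[of 0], of "x 0"] Tinv(1)[OF xT[of 0]] by simp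
  obtain t where t: "t \<in> T" "\<beta> t \<noteq> 1" using char_comb_eq_1[of m] \<beta> by metis
  have "x a = mat 1" for a
  proof -
    \<comment> \<open>Chosen so that \<open>(\<beta> t - 1) * b = a\<close>.\<close>
    define b where "b = a / (\<beta> t - 1)"
    have "x (\<beta> t * b) = x b"
      using act[OF t(1), of b] T_commute[OF t(1) xT[of b]] T_cancel(1)[OF t(1)] by metis
    then have "x (\<beta> t * b + - b) = x (b + - b)" by (simp only: hom)
    moreover have "\<beta> t * b + - b = (\<beta> t - 1) * b" by (simp add: algebra_simps)
    ultimately show ?thesis using t(2) x0 by (simp add: b_def)
  qed
  then show False using x(1) unfolding root_subgroup_def by blast
qed

text \<open>The exponents given by \<open>simple_roots\<close> are integers of one sign. For a
  subgroup in \<open>U\<close> the negative case is impossible by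
  \<open>root_subgroup_in_T_trivial\<close>, so they are natural numbers.\<close>

sublocale pos: root_cone T U \<alpha> P
proof
  fix \<beta> x
  assume a: "alg_character T \<beta>" "polycurve x" "range x \<subseteq> U" "\<And>a b. x (a + b) = x a ** x b"
    "\<exists>a. x a \<noteq> mat 1" "\<And>t a. t \<in> T \<Longrightarrow> t ** x a ** matrix_inv t = x (\<beta> t * a)"
  have rs: "root_subgroup G T \<beta> x"
    unfolding root_subgroup_def polycurve_iff[symmetric] using a in_G(2) by auto
  then obtain m where m: "m \<noteq> (\<lambda>i. 0)" "\<forall>t\<in>T. \<beta> t = char_comb \<alpha> m t"
    "(\<forall>i. 0 \<le> m i) \<and> range x \<subseteq> U \<or> (\<forall>i. m i \<le> 0) \<and> range x \<subseteq> Um"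
    using simple unfolding simple_roots_def by blast
  from m(3) show "\<exists>m. m \<noteq> (\<lambda>i. 0) \<and> (\<forall>t\<in>T. \<beta> t = char_mono \<alpha> m t)"
  proof
    assume nonneg: "(\<forall>i. 0 \<le> m i) \<and> range x \<subseteq> U"
    then have "m = (\<lambda>i. int (nat (m i)) - int 0)" by auto
    then have "\<beta> t = char_mono \<alpha> (\<lambda>i. nat (m i)) t" if "t \<in> T" for t
      using m(2) char_comb_int[OF that, of "\<lambda>i. nat (m i)" "\<lambda>i. 0"] that by simp
    moreover have "(\<lambda>i. nat (m i)) \<noteq> (\<lambda>i. 0)"
    proof
      assume "(\<lambda>i. nat (m i)) = (\<lambda>i. 0)"
      then have "m i = 0" for i using nonneg by (metis nat_eq_iff2 nat_int of_nat_0)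
      then show False using m(1) by auto
    qed
    ultimately show ?thesis by blast
  next
    assume "(\<forall>i. m i \<le> 0) \<and> range x \<subseteq> Um"
    then have "range x \<subseteq> T" using a(3) U_inter_Um by blast
    then show ?thesis using root_subgroup_in_T_trivial[OF rs _ m(1,2)] by blast
  qed
qed (use T U P diag T_normalizes alpha_char char_mono_inj in auto)

text \<open>The mirror image: with the inverse roots as the family, nonpositive exponents become
  natural numbers.\<close>

sublocale neg: root_cone T Um "\<lambda>i t. inverse (\<alpha> i t)" P
proof
  fix \<beta> x
  assume a: "alg_character T \<beta>" "polycurve x" "range x \<subseteq> Um" "\<And>a b. x (a + b) = x a ** x b"
    "\<exists>a. x a \<noteq> mat 1" "\<And>t a. t \<in> T \<Longrightarrow> t ** x a ** matrix_inv t = x (\<beta> t * a)"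
  have rs: "root_subgroup G T \<beta> x"
    unfolding root_subgroup_def polycurve_iff[symmetric] using a in_G(3) by auto
  then obtain m where m: "m \<noteq> (\<lambda>i. 0)" "\<forall>t\<in>T. \<beta> t = char_comb \<alpha> m t"
    "(\<forall>i. 0 \<le> m i) \<and> range x \<subseteq> U \<or> (\<forall>i. m i \<le> 0) \<and> range x \<subseteq> Um"
    using simple unfolding simple_roots_def by blast
  from m(3) show "\<exists>m. m \<noteq> (\<lambda>i. 0) \<and> (\<forall>t\<in>T. \<beta> t = char_mono (\<lambda>i t. inverse (\<alpha> i t)) m t)"
  proof
    assume nonpos: "(\<forall>i. m i \<le> 0) \<and> range x \<subseteq> Um"
    then have "m = (\<lambda>i. int 0 - int (nat (- m i)))" by auto
    then have "\<beta> t = char_mono (\<lambda>i t. inverse (\<alpha> i t)) (\<lambda>i. nat (- m i)) t" if "t \<in> T" for t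
      using m(2) char_comb_int[OF that, of "\<lambda>i. 0" "\<lambda>i. nat (- m i)"] that
      by (simp add: char_mono_inverse divide_inverse)
    moreover have "(\<lambda>i. nat (- m i)) \<noteq> (\<lambda>i. 0)"
    proof
      assume "(\<lambda>i. nat (- m i)) = (\<lambda>i. 0)"
      then have "m i = 0" for i using nonpos by (metis antisym nat_0_iff neg_le_0_iff_le)
      then show False using m(1) by auto
    qed
    ultimately show ?thesis by blast
  next
    assume "(\<forall>i. 0 \<le> m i) \<and> range x \<subseteq> U"
    then have "range x \<subseteq> T" using a(3) U_inter_Um by blast
    then show ?thesis using root_subgroup_in_T_trivial[OF rs _ m(1,2)] by blast
  qed
next
  fix m m'
  assume "\<And>t. t \<in> T \<Longrightarrow> char_mono (\<lambda>i t. inverse (\<alpha> i t)) m t = char_mono (\<lambda>i t. inverse (\<alpha> i t)) m' t"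
  then show "m = m'" by (intro char_mono_inj) (simp add: char_mono_inverse)
qed (use T Um P diag T_normalizes alpha_inv_char in auto)

section \<open>The images of SL(2)\<close>

definition xp where "xp i a = \<phi> i (mat2 1 a 0 1)"
definition xm where "xm i a = \<phi> i (mat2 1 0 a 1)"
text \<open>The representatives of the simple reflection in the image of SL(2):
  \<open>nr i 1\<close> is the chosen one and \<open>nr i (-1)\<close> its inverse. With the
  parameter the family is stable under multiplication by coroots and under conjugation by
  \<open>T\<close>.\<close>

definition nr where "nr i b = \<phi> i (mat2 0 (- b) (inverse b) 0)"
abbreviation h where "h i \<equiv> coroot (\<phi> i)"

lemma phi_mult: "x \<in> SL2 \<Longrightarrow> y \<in> SL2 \<Longrightarrow> \<phi> i x ** \<phi> i y = \<phi> i (x ** y)"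
  and phi_G: "x \<in> SL2 \<Longrightarrow> \<phi> i x \<in> G"
  using attached[of i] by (auto simp: attached_def alg_hom_def hom_def)

lemma phi_mat2_mult:
  "a * d - b * e = 1 \<Longrightarrow> a' * d' - b' * e' = 1 \<Longrightarrow>
   \<phi> i (mat2 a b e d) ** \<phi> i (mat2 a' b' e' d') =
   \<phi> i (mat2 (a*a' + b*e') (a*b' + b*d') (e*a' + d*e') (e*b' + d*d'))"
  by (simp add: phi_mult mat2_SL2 mat2_mult)

text \<open>An invertible idempotent is the identity.\<close>

lemma phi_one: "\<phi> i (mat2 1 0 0 1) = mat 1"
proof -
  let ?x = "\<phi> i (mat2 1 0 0 1)"
  have x: "?x ** ?x = ?x" by (simp add: phi_mat2_mult)
  have "invertible ?x" by (intro alg_groupD(3)[OF G] phi_G) (simp add: mat2_SL2)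
  from matrix_inv_mult(2)[OF this] x show ?thesis by (metis matrix_mul_assoc matrix_mul_lid)
qed

lemma rank1_G: "xp i a \<in> G" "xm i a \<in> G" "b \<noteq> 0 \<Longrightarrow> nr i b \<in> G"
  by (simp_all add: xp_def xm_def nr_def phi_G mat2_SL2)

lemma h_T: "z \<noteq> 0 \<Longrightarrow> h i z \<in> T"
  using attached[of i] by (simp add: attached_def)

lemma nr_factor: "b \<noteq> 0 \<Longrightarrow> nr i b = xp i (- b) ** xm i (inverse b) ** xp i (- b)"
  by (simp add: nr_def xp_def xm_def phi_mat2_mult)

lemma nr_inverse: "b \<noteq> 0 \<Longrightarrow> nr i b ** nr i (- b) = mat 1"
  by (simp add: nr_def phi_mat2_mult phi_one)

lemma nr_square: "nr i (-1) ** nr i (-1) = h i (-1)"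
  by (simp add: nr_def coroot_def phi_mat2_mult)

lemma h_nr: "b \<noteq> 0 \<Longrightarrow> z \<noteq> 0 \<Longrightarrow> h i z ** nr i b = nr i (b * z)"
  and nr_h: "b \<noteq> 0 \<Longrightarrow> z \<noteq> 0 \<Longrightarrow> nr i b ** h i z = nr i (b * inverse z)"
  by (simp_all add: nr_def coroot_def phi_mat2_mult mult.commute)

lemma xm_conj: "xm i a = nr i 1 ** xp i (- a) ** nr i (-1)"
  by (simp add: nr_def xp_def xm_def phi_mat2_mult)

lemma xp_root: "root_subgroup G T (\<alpha> i) (xp i)"
  and xm_root: "root_subgroup G T (\<lambda>t. inverse (\<alpha> i t)) (xm i)"
  using attached[of i] unfolding attached_def xp_def[abs_def] xm_def[abs_def] by auto

lemma T_conj_xp: "t \<in> T \<Longrightarrow> t ** xp i a ** matrix_inv t = xp i (\<alpha> i t * a)"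
  and T_conj_xm: "t \<in> T \<Longrightarrow> t ** xm i a ** matrix_inv t = xm i (inverse (\<alpha> i t) * a)"
  using xp_root[of i] xm_root[of i] unfolding root_subgroup_def by blast+

text \<open>\<open>simple_roots\<close> leaves the sign open. By independence of the simple roots
  the exponents of \<open>\<alpha> i\<close> itself form a unit vector, and the exponent 1 excludes
  the negative case.\<close>

lemma xp_U: "xp i a \<in> U"
proof -
  let ?e = "\<lambda>j. if j = i then 1 else 0 :: int"
  obtain m where m: "\<forall>t\<in>T. \<alpha> i t = char_comb \<alpha> m t"
    "(\<forall>i. 0 \<le> m i) \<and> range (xp i) \<subseteq> U \<or> (\<forall>i. m i \<le> 0) \<and> range (xp i) \<subseteq> Um"
    using simple xp_root[of i] unfolding simple_roots_def by blast
  have "(\<lambda>j. m j - ?e j) = (\<lambda>j. 0)"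
  proof (rule char_comb_eq_1)
    fix t assume t: "t \<in> T"
    have "char_comb \<alpha> (\<lambda>j. m j - ?e j) t = char_comb \<alpha> m t / (\<Prod>j\<in>UNIV. if j = i then \<alpha> j t else 1)"
      unfolding char_comb_def prod_dividef[symmetric]
      by (intro prod.cong) (auto simp: power_int_diff alphaD t)
    then show "char_comb \<alpha> (\<lambda>j. m j - ?e j) t = 1" by (simp add: m(1)[rule_format, OF t, symmetric] alphaD(2)[OF t])
  qed
  then have "m i = 1" by (auto simp: fun_eq_iff split: if_splits)
  then show ?thesis using m(2) by (auto dest: spec[of _ i])
qed

text \<open>Conjugation by \<open>t\<close> rescales each factor of
  \<open>nr_factor\<close>.\<close>

lemma T_nr: "t \<in> T \<Longrightarrow> b \<noteq> 0 \<Longrightarrow> t ** nr i b = nr i (b * \<alpha> i t) ** t"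
proof -
  assume t: "t \<in> T" and b: "b \<noteq> 0"
  have "t ** nr i b ** matrix_inv t = (t ** xp i (- b) ** matrix_inv t) ** (t ** xm i (inverse b) ** matrix_inv t)
      ** (t ** xp i (- b) ** matrix_inv t)"
    unfolding nr_factor[OF b] matrix_mul_assoc T_cancel(2)[OF t] ..
  also have "\<dots> = nr i (b * \<alpha> i t)"
    using b alphaD(2)[OF t] by (simp add: T_conj_xp T_conj_xm t nr_factor mult.commute)
  finally show ?thesis by (metis T_cancel(2)[OF t])
qed

text \<open>The element \<open>h i (inverse (\<alpha> i t)) ** t\<close> is the image of
  \<open>t\<close> under the simple reflection.\<close>

lemma T_nr': "t \<in> T \<Longrightarrow> b \<noteq> 0 \<Longrightarrow> t ** nr i b = nr i b ** (h i (inverse (\<alpha> i t)) ** t)"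
  by (simp add: T_nr nr_h matrix_mul_assoc alphaD)

lemma nr_T: "t \<in> T \<Longrightarrow> b \<noteq> 0 \<Longrightarrow> nr i b ** t = (t ** h i (inverse (\<alpha> i t))) ** nr i b"
proof -
  assume t: "t \<in> T" and b: "b \<noteq> 0"
  have "(t ** h i (inverse (\<alpha> i t))) ** nr i b = t ** nr i (b * inverse (\<alpha> i t))"
    using t b by (simp add: matrix_mul_assoc[symmetric] h_nr alphaD)
  also have "\<dots> = nr i b ** t" using t b alphaD(2)[OF t, of i] by (simp add: T_nr alphaD mult.assoc)
  finally show ?thesis ..
qed

section \<open>Minors: invariance, and translates by simple reflections\<close>

lemma omega_char: "alg_character T (\<omega> i)"
  and omega_h: "z \<noteq> 0 \<Longrightarrow> \<omega> i (h j z) = (if i = j then z else 1)"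
  using weights by (auto simp: fundamental_weights_def)

lemmas omegaD = alg_characterD[OF T omega_char]

lemma Delta_regular: "regular_on G (\<Delta> i)"
  and Delta_cell: "n \<in> Um \<Longrightarrow> t \<in> T \<Longrightarrow> u \<in> U \<Longrightarrow> \<Delta> i (n ** t ** u) = \<omega> i t"
  using minor[of i] by (auto simp: principal_minor_def minor_values_def)

text \<open>The uniqueness of the minor amounts to the density of the open cell.\<close>

lemma cell_dense:
  assumes "regular_on G f" "regular_on G g"
    "\<And>n t u. n \<in> Um \<Longrightarrow> t \<in> T \<Longrightarrow> u \<in> U \<Longrightarrow> f (n ** t ** u) = g (n ** t ** u)" "x \<in> G"
  shows "f x = g x"
proof -
  fix i :: 'r
  have "regular_on G (\<lambda>x. \<Delta> i x + (f x - g x))"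
    by (intro regular_on_add regular_on_diff Delta_regular assms)
  moreover have "minor_values T U Um (\<omega> i) (\<lambda>x. \<Delta> i x + (f x - g x))"
    by (simp add: minor_values_def assms(3) Delta_cell)
  ultimately have "\<Delta> i x + (f x - g x) = \<Delta> i x"
    using minor[of i] assms(4) unfolding principal_minor_def by blast
  then show ?thesis by simp
qed

lemma G_mult: "x \<in> G \<Longrightarrow> y \<in> G \<Longrightarrow> x ** y \<in> G"
  and G_one: "mat 1 \<in> G"
  by (simp_all add: alg_groupD[OF G])

lemma Delta_left: "g \<in> G \<Longrightarrow> regular_on G (\<lambda>x. \<Delta> i (g ** x))"
  using regular_on_translate[OF Delta_regular G _ G_one, of g] by simp

lemma Delta_right: "g \<in> G \<Longrightarrow> regular_on G (\<lambda>x. \<Delta> i (x ** g))"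
  using regular_on_translate[OF Delta_regular G G_one, of g] by simp

lemma Delta_both: "g \<in> G \<Longrightarrow> k \<in> G \<Longrightarrow> regular_on G (\<lambda>x. \<Delta> i (g ** x ** k))"
  by (rule regular_on_translate[OF Delta_regular G])

lemma Delta_Um: "n \<in> Um \<Longrightarrow> x \<in> G \<Longrightarrow> \<Delta> i (n ** x) = \<Delta> i x"
  by (rule cell_dense[OF Delta_left Delta_regular])
     (auto simp: in_G matrix_mul_assoc Delta_cell alg_groupD(2)[OF Um(1)])

lemma Delta_U: "u \<in> U \<Longrightarrow> x \<in> G \<Longrightarrow> \<Delta> i (x ** u) = \<Delta> i x"
proof (rule cell_dense[OF Delta_right Delta_regular])
  fix n t v assume "u \<in> U" "n \<in> Um" "t \<in> T" "v \<in> U"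
  then show "\<Delta> i (n ** t ** v ** u) = \<Delta> i (n ** t ** v)"
    using Delta_cell[of n t "v ** u" i] by (simp add: matrix_mul_assoc Delta_cell alg_groupD(2)[OF U(1)])
qed (auto simp: in_G)

lemma Delta_T_left: "s \<in> T \<Longrightarrow> x \<in> G \<Longrightarrow> \<Delta> i (s ** x) = \<omega> i s * \<Delta> i x"
proof (rule cell_dense[OF Delta_left regular_on_cmult[OF Delta_regular]])
  fix n t v assume s: "s \<in> T" "n \<in> Um" "t \<in> T" "v \<in> U"
  have "s ** (n ** t ** v) = (s ** n ** matrix_inv s) ** (s ** t) ** v"
    by (simp add: matrix_mul_assoc T_cancel s)
  then show "\<Delta> i (s ** (n ** t ** v)) = \<omega> i s * \<Delta> i (n ** t ** v)"
    using s by (simp add: Delta_cell T_normalizes alg_groupD(2)[OF T] omegaD)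
qed (auto simp: in_G)

lemma Delta_T_right: "s \<in> T \<Longrightarrow> x \<in> G \<Longrightarrow> \<Delta> i (x ** s) = \<Delta> i x * \<omega> i s"
proof (rule cell_dense[OF Delta_right regular_on_mult[OF Delta_regular regular_on_const]])
  fix n t v assume s: "s \<in> T" "n \<in> Um" "t \<in> T" "v \<in> U"
  have s': "matrix_inv s \<in> T" by (rule alg_groupD(4)[OF T s(1)])
  have ss: "matrix_inv (matrix_inv s) = s" by (rule matrix_inv_eqI) (rule Tinv(2)[OF s(1)])
  have "n ** t ** v ** s = n ** (t ** s) ** (matrix_inv s ** v ** s)"
    by (simp add: matrix_mul_assoc T_cancel s)
  moreover have "matrix_inv s ** v ** s \<in> U" using T_normalizes(1)[OF s' s(4)] ss by simp
  ultimately show "\<Delta> i (n ** t ** v ** s) = \<Delta> i (n ** t ** v) * \<omega> i s"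
    using s by (simp add: Delta_cell alg_groupD(2)[OF T] omegaD)
qed (auto simp: in_G)

lemma Delta_one: "\<Delta> i (mat 1) = 1"
  using Delta_cell[OF alg_groupD(1)[OF Um(1)] alg_groupD(1)[OF T] alg_groupD(1)[OF U(1)], of i]
  by (simp add: omegaD)

lemma Delta_T: "t \<in> T \<Longrightarrow> \<Delta> i t = \<omega> i t"
  using Delta_T_left[of t "mat 1" i] by (simp add: G_one Delta_one)

lemma Delta_cell_right: "n \<in> Um \<Longrightarrow> t \<in> T \<Longrightarrow> x \<in> G \<Longrightarrow> \<Delta> i (n ** t ** x) = \<omega> i t * \<Delta> i x"
  by (simp add: matrix_mul_assoc[symmetric] Delta_Um Delta_T_left G_mult in_G)

lemma Delta_cell_left: "x \<in> G \<Longrightarrow> t \<in> T \<Longrightarrow> u \<in> U \<Longrightarrow> \<Delta> i (x ** t ** u) = \<Delta> i x * \<omega> i t"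
  by (simp add: Delta_U Delta_T_right G_mult in_G)

text \<open>Moving an element of \<open>T\<close> past \<open>nr j b\<close> reflects it. The weight
  is therefore, additively, \<open>\<omega> i\<close> minus its reflection under \<open>j\<close>,
  that is, \<open>\<alpha> j\<close> for \<open>i = j\<close> and 0 otherwise.\<close>

lemma U_nr_weight:
  assumes t: "t \<in> T" and u: "u \<in> U" and b: "b \<noteq> 0"
  shows "\<Delta> i (t ** u ** matrix_inv t ** nr j b) = (if i = j then \<alpha> j t else 1) * \<Delta> i (u ** nr j b)"
proof -
  have t': "matrix_inv t \<in> T" by (rule alg_groupD(4)[OF T t])
  have "t ** u ** matrix_inv t ** nr j b = t ** (u ** (matrix_inv t ** nr j b))"
    by (simp only: matrix_mul_assoc)
  also have "\<dots> = t ** ((u ** nr j b) ** (h j (\<alpha> j t) ** matrix_inv t))"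
    by (simp add: T_nr'[OF t' b] alphaD t matrix_mul_assoc)
  finally show ?thesis
    using t t' u b by (simp add: Delta_T_left Delta_T_right G_mult in_G rank1_G alg_groupD(2)[OF T] h_T
        omegaD omega_h alphaD)
qed

lemma nr_Um_weight:
  assumes t: "t \<in> T" and n: "n \<in> Um" and b: "b \<noteq> 0"
  shows "\<Delta> i (nr j b ** (t ** n ** matrix_inv t)) = (if i = j then inverse (\<alpha> j t) else 1) * \<Delta> i (nr j b ** n)"
proof -
  have t': "matrix_inv t \<in> T" by (rule alg_groupD(4)[OF T t])
  have "nr j b ** (t ** n ** matrix_inv t) = (nr j b ** t) ** n ** matrix_inv t"
    by (simp only: matrix_mul_assoc)
  also have "\<dots> = (t ** h j (inverse (\<alpha> j t))) ** ((nr j b ** n) ** matrix_inv t)"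
    by (simp add: nr_T[OF t b] matrix_mul_assoc)
  finally show ?thesis
    using t t' n b by (simp add: Delta_T_left Delta_T_right G_mult in_G rank1_G alg_groupD(2)[OF T] h_T
        omegaD omega_h alphaD)
qed

text \<open>As a function of \<open>u\<close> the left-hand side has weight 0, hence is
  constant.\<close>

lemma Delta_U_nr:
  assumes "i \<noteq> j" "u \<in> U" "b \<noteq> 0"
  shows "\<Delta> i (u ** nr j b) = \<Delta> i (nr j b)"
proof -
  have "\<Delta> i (u ** nr j b) = \<Delta> i (mat 1 ** nr j b)"
    using assms in_G(2)
    by (intro pos.invariant_imp_const[of "\<lambda>u. \<Delta> i (u ** nr j b)"]
        regular_on_subset[OF Delta_right]) (auto simp: U_nr_weight rank1_G)
  then show ?thesis by simp
qed

lemma Delta_nr_Um: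
  assumes "i \<noteq> j" "n \<in> Um" "b \<noteq> 0"
  shows "\<Delta> i (nr j b ** n) = \<Delta> i (nr j b)"
proof -
  have "\<Delta> i (nr j b ** n) = \<Delta> i (nr j b ** mat 1)"
    using assms in_G(3)
    by (intro neg.invariant_imp_const[of "\<lambda>u. \<Delta> i (nr j b ** u)"]
        regular_on_subset[OF Delta_left]) (auto simp: nr_Um_weight rank1_G)
  then show ?thesis by simp
qed

text \<open>At first only proportionality is obtained; the constant is shown to be 1 in
  \<open>Delta_nr_eq_1\<close>.\<close>

lemma Delta_mult_nr:
  assumes "i \<noteq> j" "b \<noteq> 0" "y \<in> G"
  shows "\<Delta> i (y ** nr j b) = \<Delta> i (nr j b) * \<Delta> i y"
proof (rule cell_dense[OF Delta_right regular_on_cmult[OF Delta_regular] _ assms(3)])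
  fix n t u assume c: "n \<in> Um" "t \<in> T" "u \<in> U"
  have "\<Delta> i (n ** t ** u ** nr j b) = \<omega> i t * \<Delta> i (u ** nr j b)"
    using Delta_cell_right[OF c(1,2), of "u ** nr j b" i] c assms(2)
    by (simp add: matrix_mul_assoc G_mult in_G rank1_G)
  then show "\<Delta> i (n ** t ** u ** nr j b) = \<Delta> i (nr j b) * \<Delta> i (n ** t ** u)"
    using c assms by (simp add: Delta_U_nr Delta_cell)
qed (use assms(2) in \<open>simp add: rank1_G\<close>)

text \<open>Conjugating \<open>xp\<close> by the reflection gives \<open>xm\<close>. The constants
  contributed by \<open>nr j 1\<close> and \<open>nr j (-1)\<close> are inverse to each other, so
  right multiplication by \<open>xm j a\<close> does not change \<open>\<Delta> i\<close>; nor does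
  multiplication by elements of \<open>U\<close>. Now \<open>nr j b\<close> is a product of such
  factors.\<close>

lemma Delta_nr_eq_1:
  assumes "i \<noteq> j" "b \<noteq> 0"
  shows "\<Delta> i (nr j b) = 1"
proof -
  have xm: "\<Delta> i (y ** xm j a) = \<Delta> i y" if y: "y \<in> G" for y a
  proof -
    have "\<Delta> i (nr j (-1)) * \<Delta> i (nr j 1) = 1"
      using Delta_mult_nr[OF assms(1), of "-1" "nr j 1"] nr_inverse[of 1 j]
      by (simp add: rank1_G Delta_one)
    then show ?thesis
      using y assms(1) unfolding xm_conj matrix_mul_assoc
      by (simp add: Delta_mult_nr G_mult rank1_G Delta_U xp_U)
  qed
  have "\<Delta> i (nr j b) = \<Delta> i (mat 1 ** xp j (- b))"
    unfolding nr_factor[OF assms(2)] by (simp add: Delta_U xp_U xm rank1_G G_mult del: matrix_mul_lid) simp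
  then show ?thesis by (simp only: Delta_U xp_U G_one Delta_one)
qed

lemma Delta_nr_right: "i \<noteq> j \<Longrightarrow> b \<noteq> 0 \<Longrightarrow> y \<in> G \<Longrightarrow> \<Delta> i (y ** nr j b) = \<Delta> i y"
  by (simp add: Delta_mult_nr Delta_nr_eq_1)

lemma Delta_nr_left:
  assumes "i \<noteq> j" "b \<noteq> 0" "y \<in> G"
  shows "\<Delta> i (nr j b ** y) = \<Delta> i y"
proof (rule cell_dense[OF Delta_left Delta_regular _ assms(3)])
  fix n t u assume c: "n \<in> Um" "t \<in> T" "u \<in> U"
  have "\<Delta> i (nr j b ** (n ** t ** u)) = \<Delta> i (nr j b ** n) * \<omega> i t"
    using Delta_cell_left[OF _ c(2,3), of "nr j b ** n" i] c assms(2)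
    by (simp add: matrix_mul_assoc G_mult in_G rank1_G)
  then show "\<Delta> i (nr j b ** (n ** t ** u)) = \<Delta> i (n ** t ** u)"
    using c assms by (simp add: Delta_nr_Um Delta_nr_eq_1 Delta_cell)
qed (use assms(2) in \<open>simp add: rank1_G\<close>)

text \<open>A function of weight \<open>\<alpha> i\<close> on \<open>U\<close> vanishes at the
  identity.\<close>

lemma Delta_nr_self: "b \<noteq> 0 \<Longrightarrow> \<Delta> i (nr i b) = 0"
  using pos.simple_weight_imp_additive(1)[of "\<lambda>u. \<Delta> i (u ** nr i b)" "mat 1" "mat 1" i]
    regular_on_subset[OF Delta_right[of "nr i b" i], of U] in_G(2) alg_groupD(1)[OF U(1)]
  by (auto simp: U_nr_weight rank1_G)

lemma Delta_U_nr_add: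
  assumes "b \<noteq> 0" "u \<in> U" "v \<in> U"
  shows "\<Delta> i (u ** v ** nr i b) = \<Delta> i (u ** nr i b) + \<Delta> i (v ** nr i b)"
  using assms in_G(2)
  by (intro pos.simple_weight_imp_additive(2)[of "\<lambda>u. \<Delta> i (u ** nr i b)" _ _ i]
      regular_on_subset[OF Delta_right]) (auto simp: U_nr_weight rank1_G)

lemma Delta_nr_Um_add:
  assumes "b \<noteq> 0" "u \<in> Um" "v \<in> Um"
  shows "\<Delta> i (nr i b ** (u ** v)) = \<Delta> i (nr i b ** u) + \<Delta> i (nr i b ** v)"
  using assms in_G(3)
  by (intro neg.simple_weight_imp_additive(2)[of "\<lambda>u. \<Delta> i (nr i b ** u)" _ _ i]
      regular_on_subset[OF Delta_left]) (auto simp: nr_Um_weight rank1_G)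

text \<open>On the open cell the component of \<open>y\<close> in \<open>U\<close> is multiplied by
  \<open>u\<close>, where additivity applies; density carries this over to \<open>G\<close>.\<close>

lemma Delta_mult_U_nr:
  assumes b: "b \<noteq> 0" and u: "u \<in> U" and y: "y \<in> G"
  shows "\<Delta> i (y ** (u ** nr i b)) = \<Delta> i (y ** nr i b) + \<Delta> i (u ** nr i b) * \<Delta> i y"
proof (rule cell_dense[of "\<lambda>y. \<Delta> i (y ** (u ** nr i b))" "\<lambda>y. \<Delta> i (y ** nr i b) + \<Delta> i (u ** nr i b) * \<Delta> i y", OF _ _ _ y])
  fix n t v assume c: "n \<in> Um" "t \<in> T" "v \<in> U"
  have "\<Delta> i (n ** t ** v ** (u ** nr i b)) = \<omega> i t * \<Delta> i (v ** u ** nr i b)"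
    using Delta_cell_right[OF c(1,2), of "v ** u ** nr i b" i] c u b
    by (simp add: matrix_mul_assoc G_mult in_G rank1_G)
  moreover have "\<Delta> i (n ** t ** v ** nr i b) = \<omega> i t * \<Delta> i (v ** nr i b)"
    using Delta_cell_right[OF c(1,2), of "v ** nr i b" i] c b
    by (simp add: matrix_mul_assoc G_mult in_G rank1_G)
  ultimately show "\<Delta> i (n ** t ** v ** (u ** nr i b)) =
    \<Delta> i (n ** t ** v ** nr i b) + \<Delta> i (u ** nr i b) * \<Delta> i (n ** t ** v)"
    using Delta_U_nr_add[OF b c(3) u, of i] c by (simp add: Delta_cell algebra_simps)
qed (intro regular_on_add regular_on_cmult Delta_regular Delta_right G_mult in_G rank1_G u b)+

lemma Delta_nr_Um_mult:
  assumes b: "b \<noteq> 0" and n: "n \<in> Um" and y: "y \<in> G"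
  shows "\<Delta> i (nr i b ** n ** y) = \<Delta> i (nr i b ** y) + \<Delta> i (nr i b ** n) * \<Delta> i y"
proof (rule cell_dense[of "\<lambda>y. \<Delta> i (nr i b ** n ** y)" "\<lambda>y. \<Delta> i (nr i b ** y) + \<Delta> i (nr i b ** n) * \<Delta> i y", OF _ _ _ y])
  fix m t v assume c: "m \<in> Um" "t \<in> T" "v \<in> U"
  have "\<Delta> i (nr i b ** n ** (m ** t ** v)) = \<Delta> i (nr i b ** (n ** m)) * \<omega> i t"
    using Delta_cell_left[OF _ c(2,3), of "nr i b ** (n ** m)" i] c n b
    by (simp add: matrix_mul_assoc G_mult in_G rank1_G)
  moreover have "\<Delta> i (nr i b ** (m ** t ** v)) = \<Delta> i (nr i b ** m) * \<omega> i t"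
    using Delta_cell_left[OF _ c(2,3), of "nr i b ** m" i] c b
    by (simp add: matrix_mul_assoc G_mult in_G rank1_G)
  ultimately show "\<Delta> i (nr i b ** n ** (m ** t ** v)) =
    \<Delta> i (nr i b ** (m ** t ** v)) + \<Delta> i (nr i b ** n) * \<Delta> i (m ** t ** v)"
    using Delta_nr_Um_add[OF b n c(1), of i] c by (simp add: Delta_cell algebra_simps)
qed (intro regular_on_add regular_on_cmult Delta_regular Delta_left G_mult in_G rank1_G n b)+

section \<open>The Cartan matrix and a relation between weights\<close>

lemma cartan_sym: "c i j = c j i" and cartan_entries: "c i i = 2" "i \<noteq> j \<Longrightarrow> c i j = -1 \<or> c i j = 0"
proof -
  have "\<exists>D. \<forall>i j. c i j = (if i = j then 2 else if D i j \<or> D j i then -1 else 0)"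
    using ADE unfolding type_ADE_def
  proof (elim exE conjE)
    fix E e
    assume "\<forall>i j. c i j = (if i = j then 2 else if (e i, e j) \<in> E \<or> (e j, e i) \<in> E then -1 else 0)"
    then show ?thesis by (intro exI[of _ "\<lambda>i j. (e i, e j) \<in> E"]) simp
  qed
  then obtain D where "\<forall>i j. c i j = (if i = j then 2 else if D i j \<or> D j i then -1 else 0)" ..
  note c = this[rule_format]
  show "c i j = c j i" "c i i = 2" "i \<noteq> j \<Longrightarrow> c i j = -1 \<or> c i j = 0"
    unfolding c[of i j] c[of j i] c[of i i] by auto
qed

lemma alg_character_mult: "alg_character T \<xi> \<Longrightarrow> alg_character T \<eta> \<Longrightarrow> alg_character T (\<lambda>t. \<xi> t * \<eta> t)"
  by (simp add: alg_character_def regular_on_mult)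

lemma alg_character_prod:
  "(\<And>j. j \<in> S \<Longrightarrow> alg_character T (\<xi> j)) \<Longrightarrow> alg_character T (\<lambda>t. \<Prod>j\<in>S. \<xi> j t)"
proof (induct S rule: infinite_finite_induct)
  case (insert x F)
  then show ?case by (simp add: alg_character_mult)
qed (simp_all add: alg_character_def regular_on_const)

text \<open>Both sides are characters with the same pairing with every simple coroot, so simple
  connectedness identifies them. Additively this is the expansion of a simple root in fundamental
  weights by row \<open>i\<close> of the Cartan matrix.\<close>

lemma omega_relation:
  assumes t: "t \<in> T"
  shows "\<omega> i t * \<omega> i t * inverse (\<alpha> i t) = (\<Prod>j\<in>{j. c i j = -1}. \<omega> j t)"
proof -
  let ?\<xi> = "\<lambda>t. \<omega> i t * \<omega> i t * inverse (\<alpha> i t)" and ?\<eta> = "\<lambda>t. \<Prod>j\<in>{j. c i j = -1}. \<omega> j t"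
  let ?m = "\<lambda>k. if c i k = -1 then 1 else 0 :: int"
  have \<xi>: "alg_character T ?\<xi>" by (intro alg_character_mult omega_char alpha_inv_char)
  have \<eta>: "alg_character T ?\<eta>" by (intro alg_character_prod omega_char)
  have \<xi>h: "?\<xi> (h k z) = z powi ?m k" if z: "z \<noteq> 0" for k z
  proof -
    \<comment> \<open>\<open>cartan_matrix\<close> gives the exponent \<open>c k i\<close>; the
      matrix is symmetric in the simply laced types.\<close>
    have "\<alpha> i (h k z) = z powi c i k" using cartan z cartan_sym by (simp add: cartan_matrix_def)
    then show ?thesis
      using cartan_entries(1)[of i] cartan_entries(2)[of i k] z
      by (cases "k = i") (auto simp: omega_h power2_eq_square field_simps power_int_minus)
  qed
  have \<eta>h: "?\<eta> (h k z) = z powi ?m k" if z: "z \<noteq> 0" for k z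
    using z by (simp add: omega_h if_distrib)
  note unique = simply_connected[unfolded simply_connected_group_def, THEN spec[of _ ?m], THEN conjunct2,
    THEN spec[of _ ?\<xi>], THEN spec[of _ ?\<eta>], THEN mp, THEN mp, THEN mp, THEN mp]
  show ?thesis
  proof (rule unique[THEN bspec, OF _ _ _ _ t])
    show "alg_character T ?\<xi>" "alg_character T ?\<eta>" by (fact \<xi> \<eta>)+
    show "\<forall>k z. z \<noteq> 0 \<longrightarrow> ?\<xi> (h k z) = z powi ?m k" using \<xi>h by blast
    show "\<forall>k z. z \<noteq> 0 \<longrightarrow> ?\<eta> (h k z) = z powi ?m k" using \<eta>h by blast
  qed
qed

text \<open>The case \<open>u = v = e\<close> of Fomin and Zelevinsky's identity for generalized minors, except that
  the representative of \<open>s\<^sub>i\<close> on the right is inverted; this changes the sign of the product.\<close>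

lemma minor_identity:
  assumes y: "y \<in> G"
  shows "\<Delta> i y * \<Delta> i (nr i (-1) ** y ** nr i (-1)) =
    \<Delta> i (nr i (-1) ** y) * \<Delta> i (y ** nr i (-1)) - (\<Prod>j\<in>{j. c i j = -1}. \<Delta> j y)"
proof (rule cell_dense[of "\<lambda>y. \<Delta> i y * \<Delta> i (nr i (-1) ** y ** nr i (-1))"
    "\<lambda>y. \<Delta> i (nr i (-1) ** y) * \<Delta> i (y ** nr i (-1)) - (\<Prod>j\<in>{j. c i j = -1}. \<Delta> j y)", OF _ _ _ y])
  let ?s = "nr i (-1)"
  have s: "?s \<in> G" by (simp add: rank1_G)
  show "regular_on G (\<lambda>y. \<Delta> i y * \<Delta> i (?s ** y ** ?s))"
    by (intro regular_on_mult Delta_regular Delta_both s)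
  show "regular_on G (\<lambda>y. \<Delta> i (?s ** y) * \<Delta> i (y ** ?s) - (\<Prod>j\<in>{j. c i j = -1}. \<Delta> j y))"
    by (intro regular_on_diff regular_on_prod regular_on_mult Delta_regular Delta_left Delta_right s)
  fix n t u assume c: "n \<in> Um" "t \<in> T" "u \<in> U"
  \<comment> \<open>The three translated minors are expressed through these two numbers and
    \<open>t\<close>.\<close>
  let ?k = "\<Delta> i (u ** ?s)" and ?k' = "\<Delta> i (?s ** n)"
  have G: "n \<in> G" "t \<in> G" "u \<in> G" using c in_G by auto
  have "\<Delta> i (?s ** (n ** t ** u) ** ?s) = \<Delta> i (?s ** n ** t ** (u ** ?s))"
    by (simp add: matrix_mul_assoc)
  also have "\<dots> = \<Delta> i (?s ** n ** t ** ?s) + ?k * \<Delta> i (?s ** n ** t)"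
    by (rule Delta_mult_U_nr) (use c G s in \<open>simp_all add: G_mult\<close>)
  also have "\<Delta> i (?s ** n ** t) = ?k' * \<omega> i t"
    by (rule Delta_T_right) (use c G s in \<open>simp_all add: G_mult\<close>)
  also have "\<Delta> i (?s ** n ** t ** ?s) = \<Delta> i (?s ** (t ** ?s)) + ?k' * \<Delta> i (t ** ?s)"
    using Delta_nr_Um_mult[of "-1" n "t ** ?s" i] c G s by (simp add: G_mult matrix_mul_assoc)
  also have "\<Delta> i (t ** ?s) = 0"
    using c s by (simp add: Delta_T_left Delta_nr_self)
  \<comment> \<open>Here the sign arises: the square of \<open>?s\<close> is
    \<open>h i (-1)\<close>, where \<open>\<omega> i\<close> takes the value -1.\<close>
  also have "?s ** (t ** ?s) = t ** h i (inverse (\<alpha> i t)) ** h i (-1)"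
    using c by (simp add: matrix_mul_assoc nr_T) (simp add: matrix_mul_assoc[symmetric] nr_square)
  also have "\<Delta> i \<dots> = - (\<omega> i t * inverse (\<alpha> i t))"
    using c by (simp add: Delta_T h_T alg_groupD(2)[OF T] omegaD omega_h alphaD)
  finally have 1: "\<Delta> i (?s ** (n ** t ** u) ** ?s) = - (\<omega> i t * inverse (\<alpha> i t)) + ?k * (?k' * \<omega> i t)"
    by simp
  have 2: "\<Delta> i (?s ** (n ** t ** u)) = ?k' * \<omega> i t"
    using Delta_cell_left[OF _ c(2,3), of "?s ** n" i] s G by (simp add: matrix_mul_assoc G_mult)
  have 3: "\<Delta> i (n ** t ** u ** ?s) = \<omega> i t * ?k"
    using Delta_cell_right[OF c(1,2), of "u ** ?s" i] s G by (simp add: matrix_mul_assoc G_mult)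
  \<comment> \<open>The terms containing \<open>?k * ?k'\<close> cancel, and
    \<open>omega_relation\<close> remains.\<close>
  show "\<Delta> i (n ** t ** u) * \<Delta> i (?s ** (n ** t ** u) ** ?s) =
    \<Delta> i (?s ** (n ** t ** u)) * \<Delta> i (n ** t ** u ** ?s) - (\<Prod>j\<in>{j. c i j = -1}. \<Delta> j (n ** t ** u))"
    unfolding 1 2 3 using c by (simp add: Delta_cell omega_relation[symmetric] algebra_simps)
qed

section \<open>Powers of elements of the slice\<close>

lemma refl_rep_eq: "refl_rep (\<phi> i) = nr i 1"
  by (simp add: refl_rep_def nr_def)

lemma word_rep_append: "word_rep \<phi> (xs @ ys) = word_rep \<phi> xs ** word_rep \<phi> ys"
  by (induct xs) (simp_all add: word_rep_def matrix_mul_assoc)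

lemma word_rep_Cons: "word_rep \<phi> (i # xs) = nr i 1 ** word_rep \<phi> xs"
  by (simp add: word_rep_def refl_rep_eq)

lemma word_rep_G: "word_rep \<phi> xs \<in> G"
  by (induct xs) (simp_all add: word_rep_Cons G_mult rank1_G, simp add: word_rep_def G_one)

text \<open>Letters other than \<open>i\<close> are stripped one at a time.\<close>

lemma Delta_word_left: "i \<notin> set xs \<Longrightarrow> y \<in> G \<Longrightarrow> \<Delta> i (word_rep \<phi> xs ** y) = \<Delta> i y"
proof (induct xs arbitrary: y)
  case (Cons j xs)
  then show ?case
    by (simp add: word_rep_Cons matrix_mul_assoc[symmetric] Delta_nr_left G_mult word_rep_G)
qed (simp add: word_rep_def)

lemma Delta_word_right: "i \<notin> set xs \<Longrightarrow> y \<in> G \<Longrightarrow> \<Delta> i (y ** word_rep \<phi> xs) = \<Delta> i y"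
proof (induct xs arbitrary: y)
  case (Cons j xs)
  then show ?case
    by (simp add: word_rep_Cons matrix_mul_assoc Delta_nr_right G_mult rank1_G)
qed (simp add: word_rep_def)

lemma slice_recursion:
  assumes w: "coxeter_word w" and a: "a \<in> coxeter_slice U Um (word_rep \<phi> w)" and k: "k \<ge> 1"
  shows "(theta \<Delta> i k a)\<^sup>2 = theta \<Delta> i (k - 1) a * theta \<Delta> i (k + 1) a + (\<Prod>j\<in>{j. c i j = -1}. theta \<Delta> j k a)"
proof -
  \<comment> \<open>The letter \<open>i\<close> occurs exactly once, and every other letter lies in
    exactly one of \<open>w1\<close> and \<open>w2\<close>.\<close>
  obtain w1 w2 where w12: "w = w1 @ i # w2" using w by (metis UNIV_I coxeter_word_def split_list)
  have dist: "i \<notin> set w1" "i \<notin> set w2" "set w1 \<inter> set w2 = {}" "set w1 \<union> set w2 \<union> {i} = UNIV"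
    using w by (auto simp: coxeter_word_def w12)
  define C R1 R2 s where "C = word_rep \<phi> w" "R1 = word_rep \<phi> w1" "R2 = word_rep \<phi> w2" "s = nr i (-1)"
  note defs = this
  define C' R1' R2' where "C' = matrix_inv C" "R1' = matrix_inv R1" "R2' = matrix_inv R2"
  note defs' = this
  have inG: "C \<in> G" "R1 \<in> G" "R2 \<in> G" "s \<in> G" "C' \<in> G" "R1' \<in> G" "R2' \<in> G"
    unfolding defs' by (simp_all add: defs word_rep_G rank1_G alg_groupD(4)[OF G])
  have inv: "C' ** C = mat 1" "R1 ** R1' = mat 1" "R1' ** R1 = mat 1" "R2 ** R2' = mat 1" "R2' ** R2 = mat 1" "C ** C' = mat 1"
    unfolding defs' by (simp_all add: matrix_inv_mult alg_groupD(3)[OF G] inG)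
  have C: "C = R1 ** (nr i 1 ** R2)"
    by (simp add: defs w12 word_rep_append word_rep_Cons)
  have ns: "nr i 1 ** s = mat 1" using nr_inverse[of 1 i] by (simp add: defs)
  have C': "C' = R2' ** s ** R1'"
  proof -
    have "C ** (R2' ** s ** R1') = R1 ** (nr i 1 ** (R2 ** R2') ** s) ** R1'"
      unfolding C by (simp only: matrix_mul_assoc)
    then have "C ** (R2' ** s ** R1') = mat 1" by (simp add: inv ns)
    then show ?thesis unfolding defs' by (rule matrix_inv_eqI)
  qed
  have inv_left: "\<Delta> j (R1' ** y) = \<Delta> j y" if "j \<notin> set w1" "y \<in> G" for j y
    using Delta_word_left[OF that(1), of "R1' ** y"] that(2) inG inv
    by (simp add: G_mult matrix_mul_assoc flip: defs(2))
  have inv_left2: "\<Delta> j (R2' ** y) = \<Delta> j y" if "j \<notin> set w2" "y \<in> G" for j y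
    using Delta_word_left[OF that(1), of "R2' ** y"] that(2) inG inv
    by (simp add: G_mult matrix_mul_assoc flip: defs(3))
  have inv_right: "\<Delta> j (y ** R1') = \<Delta> j y" if "j \<notin> set w1" "y \<in> G" for j y
    using Delta_word_right[OF that(1), of "y ** R1'"] that(2) inG inv
    by (simp add: G_mult matrix_mul_assoc[symmetric] flip: defs(2))
  have inv_right2: "\<Delta> j (y ** R2') = \<Delta> j y" if "j \<notin> set w2" "y \<in> G" for j y
    using Delta_word_right[OF that(1), of "y ** R2'"] that(2) inG inv
    by (simp add: G_mult matrix_mul_assoc[symmetric] flip: defs(3))
  obtain u n where un: "u \<in> U" "n \<in> Um" "a = u ** C" "u = C ** n ** C'"
    using a unfolding coxeter_slice_def defs' defs by blast
  have aC: "a ** C' = u" using un(3) inv by (simp add: matrix_mul_assoc[symmetric])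
  have "C' ** a = (C' ** C) ** n ** (C' ** C)"
    unfolding un(3,4) by (simp only: matrix_mul_assoc)
  then have Ca: "C' ** a = n" by (simp add: inv)
  have aG: "a \<in> G" using un inG by (simp add: G_mult in_G)
  have pG: "mpow a l \<in> G" for l by (rule mpow_in_alg_group[OF G aG])
  obtain l where l: "k = Suc l" using k by (cases k) auto
  define x where "x = mpow a (Suc k)"
  \<comment> \<open>As \<open>a\<close> equals both \<open>u ** C\<close> and \<open>C ** n\<close>,
    each factor \<open>C'\<close> next to \<open>x\<close> removes one power of \<open>a\<close>, up
    to an element of \<open>Um\<close> on the left or of \<open>U\<close> on the right, which the
    minors ignore.\<close>
  have x1: "C' ** x = n ** mpow a k"
    unfolding x_def mpow_Suc2 matrix_mul_assoc Ca ..
  have x2: "x ** C' = mpow a k ** u"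
    unfolding x_def mpow.simps matrix_mul_assoc[symmetric] aC ..
  have x3: "C' ** x ** C' = n ** mpow a l ** u"
    unfolding x1 l mpow.simps matrix_mul_assoc[symmetric] aC ..
  have xG: "x \<in> G" unfolding x_def by (rule pG)
  define y where "y = R1' ** x ** R2'"
  have yG: "y \<in> G" by (simp add: y_def G_mult inG xG)
  \<comment> \<open>The convention that \<open>theta\<close> is 1 at exponent 0 agrees with the
    minor of \<open>mat 1\<close>, so \<open>k = 1\<close> is no exception.\<close>
  have th: "theta \<Delta> j m a = \<Delta> j (mpow a m)" for j m
    by (simp add: theta_def mat_monoid_pow Delta_one)
  have e1: "\<Delta> i y = theta \<Delta> i (k + 1) a"
    by (simp add: y_def th inv_right2 inv_left dist G_mult inG xG flip: x_def del: mpow.simps)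
  \<comment> \<open>The letter \<open>i\<close> does not occur in \<open>w1\<close> or
    \<open>w2\<close>, so \<open>R2'\<close> on the left and \<open>R1'\<close> on the right may be
    inserted; they complete \<open>s ** y ** s\<close> to \<open>C' ** x ** C'\<close>.\<close>
  have e2: "\<Delta> i (s ** y ** s) = theta \<Delta> i (k - 1) a"
  proof -
    have "\<Delta> i (s ** y ** s) = \<Delta> i (R2' ** (s ** y ** s) ** R1')"
      by (simp add: inv_right inv_left2 dist G_mult inG yG)
    also have "R2' ** (s ** y ** s) ** R1' = C' ** x ** C'"
      unfolding C' y_def by (simp only: matrix_mul_assoc)
    finally show ?thesis
      unfolding x3 by (simp add: th l Delta_U Delta_Um un(1,2) pG G_mult in_G)
  qed
  have left: "\<Delta> j (C' ** x) = theta \<Delta> j k a" for j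
    by (simp add: x1 th Delta_Um un(1,2) pG)
  have right: "\<Delta> j (x ** C') = theta \<Delta> j k a" for j
    by (simp add: x2 th Delta_U un(1,2) pG)
  have e3: "\<Delta> i (s ** y) = theta \<Delta> i k a"
  proof -
    have "\<Delta> i (s ** y) = \<Delta> i (R2' ** (s ** R1' ** x) ** R2')"
      unfolding y_def
      by (simp add: inv_right2 inv_left2 dist G_mult inG xG matrix_mul_assoc[of s])
    also have "\<dots> = \<Delta> i (C' ** x)"
      unfolding C' by (simp add: inv_right2 dist G_mult inG xG) (simp only: matrix_mul_assoc)
    finally show ?thesis by (simp only: left)
  qed
  have e4: "\<Delta> i (y ** s) = theta \<Delta> i k a"
  proof -
    have "\<Delta> i (y ** s) = \<Delta> i (R1' ** (x ** R2' ** s))"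
      unfolding y_def by (simp only: matrix_mul_assoc)
    also have "\<dots> = \<Delta> i (x ** R2' ** s ** R1')"
      by (simp add: inv_right inv_left dist G_mult inG xG)
    also have "x ** R2' ** s ** R1' = x ** C'"
      unfolding C' by (simp only: matrix_mul_assoc)
    finally show ?thesis by (simp only: right)
  qed
  have e5: "\<Delta> j y = theta \<Delta> j k a" if j: "c i j = -1" for j
  proof -
    have ij: "j \<noteq> i" using j cartan_entries(1)[of i] by auto
    \<comment> \<open>Depending on the word in which \<open>j\<close> occurs, the factors that
      complete \<open>C'\<close> are supplied on the left or on the right of \<open>x\<close>; they
      involve only letters different from \<open>j\<close>.\<close>
    show ?thesis
    proof (cases "j \<in> set w1")
      case True
      then have j2: "j \<notin> set w2" using dist by auto
      have "\<Delta> j y = \<Delta> j (R1' ** x)" by (simp add: y_def inv_right2 j2 G_mult inG xG)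
      also have "\<dots> = \<Delta> j (R2' ** (s ** (R1' ** x)))"
        using ij by (simp add: inv_left2 j2 G_mult inG xG) (simp add: defs(4) Delta_nr_left G_mult inG xG)
      also have "R2' ** (s ** (R1' ** x)) = C' ** x"
        unfolding C' by (simp only: matrix_mul_assoc)
      finally show ?thesis by (simp only: left)
    next
      case False
      have "\<Delta> j y = \<Delta> j (x ** R2')"
        by (simp add: y_def matrix_mul_assoc[symmetric] inv_left False G_mult inG xG)
      also have "\<dots> = \<Delta> j (x ** R2' ** s ** R1')"
        using ij by (simp add: inv_right False G_mult inG xG) (simp add: defs(4) Delta_nr_right G_mult inG xG)
      also have "x ** R2' ** s ** R1' = x ** C'"
        unfolding C' by (simp only: matrix_mul_assoc)
      finally show ?thesis by (simp only: right)
    qed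
  qed
  have "(\<Prod>j\<in>{j. c i j = -1}. \<Delta> j y) = (\<Prod>j\<in>{j. c i j = -1}. theta \<Delta> j k a)"
    by (rule prod.cong) (simp_all add: e5)
  with minor_identity[OF yG, of i] show ?thesis
    unfolding defs(4)[symmetric] e1 e2 e3 e4 by (simp add: power2_eq_square mult.commute)
qed

end

theorem proposition7:
  fixes G T B Bm U Um :: "(complex^'n^'n) set"
    and \<alpha> \<omega> \<Delta> :: "'r::finite \<Rightarrow> complex^'n^'n \<Rightarrow> complex"
    and \<phi> :: "'r \<Rightarrow> complex^2^2 \<Rightarrow> complex^'n^'n"
    and c :: "'r \<Rightarrow> 'r \<Rightarrow> int"
    and w :: "'r list"
  assumes "simple_alg_group G"
    and "maximal_torus G T"
    and "opposite_borels G T B Bm"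
    and "unipotent_radical B U"
    and "unipotent_radical Bm Um"
    and "simple_roots G T U Um \<alpha>"
    and "\<And>i. attached G T (\<alpha> i) (\<phi> i)"
    and "cartan_matrix \<alpha> \<phi> c"
    and "type_ADE c"
    and "simply_connected_group T \<phi>"
    and "fundamental_weights T \<phi> \<omega>"
    and "\<And>i. principal_minor G T U Um (\<omega> i) (\<Delta> i)"
    and "coxeter_word w"
  shows "\<forall>a \<in> coxeter_slice U Um (word_rep \<phi> w). \<forall>k\<ge>1. \<forall>i.
           (theta \<Delta> i k a)\<^sup>2 =
             theta \<Delta> i (k - 1) a * theta \<Delta> i (k + 1) a +
             (\<Prod>j\<in>{j. c i j = -1}. theta \<Delta> j k a)"
proof -
  obtain P :: "complex^'n^'n" where P: "invertible P" "\<And>t. t \<in> T \<Longrightarrow> diagonal (P ** t ** matrix_inv P)"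
    using assms(2) unfolding maximal_torus_def alg_torus_def by blast
  have G: "alg_group G"
    using assms(1) by (simp add: simple_alg_group_def connected_alg_group_def)
  have T: "alg_group T"
    using assms(2) by (simp add: maximal_torus_def alg_torus_def connected_alg_group_def)
  have B: "alg_group B" "B \<subseteq> G" "alg_group Bm" "Bm \<subseteq> G" "B \<inter> Bm = T"
    using assms(3) by (simp_all add: opposite_borels_def borel_subgroup_def connected_alg_group_def)
  have U: "alg_group U" "normal U (GLs B)" "\<And>u. u \<in> U \<Longrightarrow> unipotent u"
    and Um: "alg_group Um" "normal Um (GLs Bm)" "\<And>u. u \<in> Um \<Longrightarrow> unipotent u"
    using assms(4,5) by (simp_all add: unipotent_radical_def unipotent_normal_def connected_alg_group_def)
  interpret minor_setting G T B Bm U Um \<alpha> \<omega> \<Delta> \<phi> c P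
    by (rule minor_setting.intro) (fact G T B U Um P assms)+
  show ?thesis using slice_recursion[OF assms(13)] by blast
qed

end
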